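(* Fix $h\in\mathbb C^\times$, let $U\subseteq\mathbb C$ be half-step-invariant, let $X:U\to\mathbb C$ be an admissible map, and let $D,S:\mathcal P\to\mathcal P$ be the associated divided-difference and averaging operators, with transposes $\mathbf D,\mathbf S:\mathcal P'\to\mathcal P'$. Let $\mathbf u\in\mathcal P'$ be such that $\langle\mathbf u,1\rangle\neq0$, and assume that there exist polynomials $\phi(x)=\phi_2x^2+\phi_1x+\phi_0$ and $\psi(x)=\psi_1x+\psi_0$, not both identically zero, such that $$\mathbf D(\phi\,\mathbf u)=\mathbf S(\psi\,\mathbf u)$$ in $\mathcal P'$. Assume that $X$ belongs to the $q$-exponential branch, fix one of the two global characteristic roots $q$, with $q$ not a root of unity, let $q^{1/2}$ be the half-step-compatible square root, and fix $s_0\in U$; let $c$, $a_{s_0}$, $b_{s_0}$ be the resulting constants in $X(s_0+kh)=a_{s_0}q^k+b_{s_0}q^{-k}+c$ ($k\in\mathbb Z$). Set $\Pi=a_{s_0}b_{s_0}$ (which is independent of the chosen progression), $$\alpha_n=\frac{q^{n/2}+q^{-n/2}}2,\qquad \gamma_n=\frac{q^{n/2}-q^{-n/2}}{q^{1/2}-q^{-1/2}},\qquad \alpha=\alpha_1,$$ $$d_n=\phi_2\gamma_n+\psi_1\alpha_n,\qquad e_n=(2\phi_2c+\phi_1)\gamma_n+(\psi_1c+\psi_0)\alpha_n,$$ and $$\phi^{[n]}(x)=\bigl(\psi_1(\alpha^2-1)\gamma_{2n}+\phi_2\alpha_{2n}\bigr)\bigl((x-c)^2-2\Pi\bigr)+\bigl(\phi'(c)\alpha_n+\psi(c)(\alpha^2-1)\gamma_n\bigr)(x-c)+\phi(c)+2\phi_2\Pi.$$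 (Infinite case, $I=\mathbb N$.) There exists a monic orthogonal polynomial sequence $(P_n)_{n\in\mathbb N}$ with respect to $\mathbf u$ if and only if $$d_j\neq0\ (j\in\mathbb N)\quad\text{and}\quad \phi^{[n]}\!\left(c-\frac{e_n}{d_{2n}}\right)\neq0\ (n\in\mathbb N).$$ (Finite case, $I=\{0,1,\dots,N+1\}$ with $N\in\mathbb N$.) Assume $d_j\neq0$ for $j=0,1,\dots,2N+1$. Then there exists a monic orthogonal polynomial sequence $(P_n)_{n\in I}$ with respect to $\mathbf u$ if and only if $$\phi^{[n]}\!\left(c-\frac{e_n}{d_{2n}}\right)\neq0,\qquad n=0,1,\dots,N.$$ Put $K_I=\mathbb N$ in the infinite case and $K_I=\{0,1,\dots,N\}$ in the finite case. Whenever the non-vanishing conditions displayed for the respective case hold, the monic orthogonal polynomial sequence is uniquely determined by $P_{-1}=0$, $P_0=1$ and $$P_{n+1}(x)=(x-B_n)P_n(x)-C_nP_{n-1}(x),\qquad n\in K_I$$ (the term $C_0P_{-1}$ being void), where $$B_0=c-\frac{\gamma_1e_0}{d_0},\qquad C_1=-\frac{\gamma_1}{d_1}\,\phi^{[0]}\!\left(c-\frac{e_0}{d_0}\right),$$ and, for every $n\in K_I\setminus\{0\}$, $$B_n=c+\frac{\gamma_ne_{n-1}}{d_{2n-2}}-\frac{\gamma_{n+1}e_n}{d_{2n}},\qquad C_{n+1}=-\frac{\gamma_{n+1}d_{n-1}}{d_{2n-1}d_{2n+1}}\,\phi^{[n]}\!\left(c-\frac{e_n}{d_{2n}}\right).$$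 In the finite case the last coefficient $C_{N+1}$ is the terminal norm coefficient $\langle\mathbf u,P_{N+1}^2\rangle/\langle\mathbf u,P_N^2\rangle$; it is not used to construct a polynomial $P_{N+2}$.
   Context: $\mathbb N=\{0,1,2,\dots\}$, $\mathbb C^\times=\mathbb C\setminus\{0\}$. Fix $h\in\mathbb C^\times$. A non-empty set $U\subseteq\mathbb C$ is half-step-invariant if $U\pm\frac h2\subseteq U$. For $X:U\to\mathbb C$ put $Y(s)=X(s+\frac h2)$, $Z(s)=X(s-\frac h2)$, $Y_1(s)=X(s+h)$, $Z_1(s)=X(s-h)$. $X$ is parametrising if $Y-Z$ vanishes nowhere on $U$; it is admissible if moreover $X(U)$ is infinite and for every complex polynomial $p$ of degree $\ge1$ there is a polynomial $Q$ with $\deg Q\le\deg p-1$ and $\frac{p(Y)-p(Z)}{Y-Z}=Q(X)$ throughout $U$. $\mathcal P$ is the space of complex polynomials, the inductive limit of the finite-dimensional spaces $\mathcal P_n$ of polynomials of degree at most $n$; its continuous dual $\mathcal P'$ coincides with the space of all linear functionals on $\mathcal P$. For admissible $X$, $Dp$ and $Sp$ are the unique polynomials with $(Dp)(X)=\frac{p(Y)-p(Z)}{Y-Z}$ and $(Sp)(X)=\frac{p(Y)+p(Z)}2$ throughout $U$. On $\mathcal P'$: $\langle p_0\mathbf u,p\rangle=\langle\mathbf u,p_0p\rangle$, $\langle\mathbf D\mathbf u,p\rangle=-\langle\mathbf u,Dp\rangle$, $\langle\mathbf S\mathbf u,p\rangle=\langle\mathbf u,Sp\rangle$. A family $(P_n)_{n\in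 I}$ with $\deg P_n=n$ is orthogonal with respect to $\mathbf u$ if $\langle\mathbf u,P_nP_m\rangle=0$ for $m,n\in I$, $m<n$, and $\langle\mathbf u,P_n^2\rangle\neq0$ for $n\in I$. Branch data (known facts for admissible $X$): there are unique constants $\eta,\beta\in\mathbb C$ with $Y+Z=\eta X+\beta$ throughout $U$, and then $Y_1+Z_1=AX+B$ with $A=\eta^2-2$, $B=(\eta+2)\beta$. $X$ belongs to the $q$-exponential branch if $\eta\notin\{0,2,-2\}$ (equivalently $A^2\neq4$). The global characteristic roots are the two solutions $q$ of $q+q^{-1}=A$ (so $q\ne\pm1$). Once $q$ is fixed, the half-step-compatible root $q^{1/2}$ is the unique square root of $q$ with $q^{1/2}+q^{-1/2}=\eta$, and $q^{n/2}=(q^{1/2})^n$ for $n\in\mathbb Z$. For every $s_0\in U$ there are unique $a_{s_0},b_{s_0}\in\mathbb C$ with $X(s_0+kh)=a_{s_0}q^k+b_{s_0}q^{-k}+c$ for all $k\in\mathbb Z$, where $c=B/(2-A)$ does not depend on $s_0$; the product $a_{s_0}b_{s_0}$ does not depend on $s_0$. *)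

theory Defs
  imports "HOL-Analysis.Analysis"
begin

section \<open>Admissible maps and their operators\<close>

text \<open>A map \<open>X : U \<rightarrow> \<complex>\<close> is represented by a total function of which only the values on \<open>U\<close>
  are ever used.\<close>

definition half_step_invariant :: "complex \<Rightarrow> complex set \<Rightarrow> bool" where
  "half_step_invariant h U \<longleftrightarrow> U \<noteq> {} \<and> (\<forall>s\<in>U. s + h / 2 \<in> U \<and> s - h / 2 \<in> U)"

definition parametrising :: "complex \<Rightarrow> complex set \<Rightarrow> (complex \<Rightarrow> complex) \<Rightarrow> bool" where
  "parametrising h U X \<longleftrightarrow> (\<forall>s\<in>U. X (s + h / 2) - X (s - h / 2) \<noteq> 0)"

definition admissible :: "complex \<Rightarrow> complex set \<Rightarrow> (complex \<Rightarrow> complex) \<Rightarrow> bool" where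
  "admissible h U X \<longleftrightarrow> parametrising h U X \<and> infinite (X ` U) \<and>
     (\<forall>p :: complex poly. degree p \<ge> 1 \<longrightarrow>
        (\<exists>Q. degree Q \<le> degree p - 1 \<and>
          (\<forall>s\<in>U. (poly p (X (s + h / 2)) - poly p (X (s - h / 2))) / (X (s + h / 2) - X (s - h / 2))
                 = poly Q (X s))))"

definition div_diff ::
    "complex \<Rightarrow> complex set \<Rightarrow> (complex \<Rightarrow> complex) \<Rightarrow> complex poly \<Rightarrow> complex poly" where
  "div_diff h U X p = (THE r. \<forall>s\<in>U. poly r (X s) =
     (poly p (X (s + h / 2)) - poly p (X (s - h / 2))) / (X (s + h / 2) - X (s - h / 2)))"

definition averaging ::
    "complex \<Rightarrow> complex set \<Rightarrow> (complex \<Rightarrow> complex) \<Rightarrow> complex poly \<Rightarrow> complex poly" where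
  "averaging h U X p = (THE r. \<forall>s\<in>U. poly r (X s) =
     (poly p (X (s + h / 2)) + poly p (X (s - h / 2))) / 2)"

definition lattice_consts ::
    "complex \<Rightarrow> complex set \<Rightarrow> (complex \<Rightarrow> complex) \<Rightarrow> complex \<times> complex" where
  "lattice_consts h U X =
     (THE (\<eta>, \<beta>). \<forall>s\<in>U. X (s + h / 2) + X (s - h / 2) = \<eta> * X s + \<beta>)"

definition lattice_eta :: "complex \<Rightarrow> complex set \<Rightarrow> (complex \<Rightarrow> complex) \<Rightarrow> complex" where
  "lattice_eta h U X = fst (lattice_consts h U X)"

definition lattice_beta :: "complex \<Rightarrow> complex set \<Rightarrow> (complex \<Rightarrow> complex) \<Rightarrow> complex" where
  "lattice_beta h U X = snd (lattice_consts h U X)"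

definition q_exponential_branch :: "complex \<Rightarrow> complex set \<Rightarrow> (complex \<Rightarrow> complex) \<Rightarrow> bool" where
  "q_exponential_branch h U X \<longleftrightarrow> lattice_eta h U X \<notin> {0, 2, -2}"


section \<open>The dual of the space of polynomials\<close>

text \<open>The continuous dual of the inductive limit of the finite-dimensional spaces of polynomials of
  degree at most \<open>n\<close> is the full algebraic dual.\<close>

definition poly_dual :: "(complex poly \<Rightarrow> complex) set" where
  "poly_dual = {u. Vector_Spaces.linear smult (*) u}"

definition poly_mult_dual ::
    "complex poly \<Rightarrow> (complex poly \<Rightarrow> complex) \<Rightarrow> complex poly \<Rightarrow> complex" where
  "poly_mult_dual p\<^sub>0 u = (\<lambda>p. u (p\<^sub>0 * p))"

definition div_diff_dual :: "complex \<Rightarrow> complex set \<Rightarrow> (complex \<Rightarrow> complex) \<Rightarrow>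
    (complex poly \<Rightarrow> complex) \<Rightarrow> complex poly \<Rightarrow> complex" where
  "div_diff_dual h U X u = (\<lambda>p. - u (div_diff h U X p))"

definition averaging_dual :: "complex \<Rightarrow> complex set \<Rightarrow> (complex \<Rightarrow> complex) \<Rightarrow>
    (complex poly \<Rightarrow> complex) \<Rightarrow> complex poly \<Rightarrow> complex" where
  "averaging_dual h U X u = (\<lambda>p. u (averaging h U X p))"


section \<open>Orthogonal families\<close>

definition orthogonal_family ::
    "(complex poly \<Rightarrow> complex) \<Rightarrow> nat set \<Rightarrow> (nat \<Rightarrow> complex poly) \<Rightarrow> bool" where
  "orthogonal_family u I P \<longleftrightarrow>
     (\<forall>n\<in>I. degree (P n) = n) \<and>
     (\<forall>m\<in>I. \<forall>n\<in>I. m < n \<longrightarrow> u (P n * P m) = 0) \<and>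
     (\<forall>n\<in>I. u ((P n)\<^sup>2) \<noteq> 0)"

definition monic_orthogonal_family ::
    "(complex poly \<Rightarrow> complex) \<Rightarrow> nat set \<Rightarrow> (nat \<Rightarrow> complex poly) \<Rightarrow> bool" where
  "monic_orthogonal_family u I P \<longleftrightarrow>
     orthogonal_family u I P \<and> (\<forall>n\<in>I. lead_coeff (P n) = 1)"

text \<open>The case distinction implements the convention \<open>P\<^bsub>-1\<^esub> = 0\<close>; the value \<open>C 0\<close> is never used.\<close>

definition three_term_recurrence ::
    "nat set \<Rightarrow> (nat \<Rightarrow> complex) \<Rightarrow> (nat \<Rightarrow> complex) \<Rightarrow> (nat \<Rightarrow> complex poly) \<Rightarrow> bool" where
  "three_term_recurrence K B C P \<longleftrightarrow>
     P 0 = 1 \<and>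
     (\<forall>n\<in>K. P (n + 1) = [:- B n, 1:] * P n - (if n = 0 then 0 else smult (C n) (P (n - 1))))"


section \<open>Well-definedness\<close>

lemma poly_eq_on_image:
  fixes p r :: "complex poly"
  assumes "infinite (X ` U)" "\<And>s. s \<in> U \<Longrightarrow> poly p (X s) = poly r (X s)"
  shows "p = r"
proof (rule ccontr)
  assume "p \<noteq> r"
  then have "finite {x. poly (p - r) x = 0}" by (intro poly_roots_finite) simp
  moreover have "X ` U \<subseteq> {x. poly (p - r) x = 0}" using assms(2) by auto
  ultimately show False using assms(1) finite_subset by blast
qed

lemma admissibleE:
  assumes "admissible h U X" "degree p \<ge> 1"
  obtains Q where "degree Q \<le> degree p - 1" "\<forall>s\<in>U. poly Q (X s) =
     (poly p (X (s + h / 2)) - poly p (X (s - h / 2))) / (X (s + h / 2) - X (s - h / 2))"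
proof -
  have "\<exists>Q. degree Q \<le> degree p - 1 \<and>
      (\<forall>s\<in>U. (poly p (X (s + h / 2)) - poly p (X (s - h / 2))) / (X (s + h / 2) - X (s - h / 2))
             = poly Q (X s))"
    using assms unfolding admissible_def by blast
  then obtain Q where Q: "degree Q \<le> degree p - 1" and
    "\<forall>s\<in>U. (poly p (X (s + h / 2)) - poly p (X (s - h / 2))) / (X (s + h / 2) - X (s - h / 2))
             = poly Q (X s)" by (elim exE conjE)
  then show thesis by (intro that[of Q]) simp_all
qed

lemma div_diff_ex1:
  assumes "admissible h U X"
  shows "\<exists>!r. \<forall>s\<in>U. poly r (X s) =
     (poly p (X (s + h / 2)) - poly p (X (s - h / 2))) / (X (s + h / 2) - X (s - h / 2))"
proof (rule ex_ex1I)
  show "\<exists>r. \<forall>s\<in>U. poly r (X s) =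
     (poly p (X (s + h / 2)) - poly p (X (s - h / 2))) / (X (s + h / 2) - X (s - h / 2))"
  proof (cases "degree p \<ge> 1")
    case True
    then show ?thesis by (rule admissibleE[OF assms]) (rule exI)
  next
    case False
    then have "degree p = 0" by simp
    then obtain k where "p = [:k:]" by (rule degree_eq_zeroE)
    then show ?thesis by (intro exI[of _ 0]) simp
  qed
next
  fix r r'
  assume r: "\<forall>s\<in>U. poly r (X s) =
      (poly p (X (s + h / 2)) - poly p (X (s - h / 2))) / (X (s + h / 2) - X (s - h / 2))"
    and r': "\<forall>s\<in>U. poly r' (X s) =
      (poly p (X (s + h / 2)) - poly p (X (s - h / 2))) / (X (s + h / 2) - X (s - h / 2))"
  have "infinite (X ` U)" using assms unfolding admissible_def by blast
  then show "r = r'" by (rule poly_eq_on_image) (simp add: r r')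
qed

lemma div_diff_eq:
  assumes "admissible h U X" "s \<in> U"
  shows "poly (div_diff h U X p) (X s) =
     (poly p (X (s + h / 2)) - poly p (X (s - h / 2))) / (X (s + h / 2) - X (s - h / 2))"
  using theI'[OF div_diff_ex1[OF assms(1), of p]] assms(2) unfolding div_diff_def by blast

lemma lattice_consts_ex1:
  assumes "admissible h U X"
  shows "\<exists>!(\<eta>, \<beta>). \<forall>s\<in>U. X (s + h / 2) + X (s - h / 2) = \<eta> * X s + \<beta>"
proof -
  have nz: "X (s + h / 2) - X (s - h / 2) \<noteq> 0" if "s \<in> U" for s
    using assms that unfolding admissible_def parametrising_def by blast
  have inf: "infinite (X ` U)" using assms unfolding admissible_def by blast
  have deg: "degree ([:0, 0, 1:] :: complex poly) = 2" by simp
  then have "degree ([:0, 0, 1:] :: complex poly) \<ge> 1" by linarith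
  then obtain Q where "degree Q \<le> degree ([:0, 0, 1:] :: complex poly) - 1" and Qeq: "\<forall>s\<in>U. poly Q (X s) =
      (poly [:0, 0, 1:] (X (s + h / 2)) - poly [:0, 0, 1:] (X (s - h / 2))) /
        (X (s + h / 2) - X (s - h / 2))"
    by (rule admissibleE[OF assms])
  then have Q: "degree Q \<le> 1" unfolding deg by simp
  have "Q = [:coeff Q 0, coeff Q 1:]"
  proof (rule poly_eqI)
    fix n show "coeff Q n = coeff [:coeff Q 0, coeff Q 1:] n"
    proof (cases "n \<le> 1")
      case True
      then have "n = 0 \<or> n = 1" by linarith
      then show ?thesis by auto
    next
      case False
      then obtain m where "n = Suc (Suc m)" by (metis One_nat_def Suc_le_mono le0 not0_implies_Suc)
      then show ?thesis using Q False by (simp add: coeff_eq_0)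
    qed
  qed
  then have Qx: "poly Q x = poly [:coeff Q 0, coeff Q 1:] x" for x by (rule arg_cong)
  have sq: "(y * y - z * z) / (y - z) = y + z" if "y - z \<noteq> 0" for y z :: complex
    using that by (simp add: square_diff_square_factored)
  have Q2: "X (s + h / 2) + X (s - h / 2) = coeff Q 1 * X s + coeff Q 0" if "s \<in> U" for s
  proof -
    have "X (s + h / 2) + X (s - h / 2) = poly Q (X s)"
      using sq[OF nz[OF that]] bspec[OF Qeq that] by simp
    also have "\<dots> = coeff Q 1 * X s + coeff Q 0" unfolding Qx by (simp add: mult.commute)
    finally show ?thesis .
  qed
  show ?thesis
  proof (rule ex1I[of _ "(coeff Q 1, coeff Q 0)"])
    show "case (coeff Q 1, coeff Q 0) of
        (\<eta>, \<beta>) \<Rightarrow> \<forall>s\<in>U. X (s + h / 2) + X (s - h / 2) = \<eta> * X s + \<beta>"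
      using Q2 by simp
  next
    fix t
    assume t: "case t of (\<eta>, \<beta>) \<Rightarrow> \<forall>s\<in>U. X (s + h / 2) + X (s - h / 2) = \<eta> * X s + \<beta>"
    obtain e b where e: "t = (e, b)" by (cases t)
    have "[:b, e:] = [:coeff Q 0, coeff Q 1:]"
    proof (rule poly_eq_on_image[OF inf])
      fix s assume "s \<in> U"
      then have "e * X s + b = coeff Q 1 * X s + coeff Q 0" using t e Q2 by simp
      then show "poly [:b, e:] (X s) = poly [:coeff Q 0, coeff Q 1:] (X s)"
        by (simp add: algebra_simps)
    qed
    then show "t = (coeff Q 1, coeff Q 0)" using e by simp
  qed
qed

lemma lattice_consts_eq:
  assumes "admissible h U X" "s \<in> U"
  shows "X (s + h / 2) + X (s - h / 2) = lattice_eta h U X * X s + lattice_beta h U X"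
proof -
  obtain e b where eb: "lattice_consts h U X = (e, b)" by (cases "lattice_consts h U X")
  have "case lattice_consts h U X of
      (\<eta>, \<beta>) \<Rightarrow> \<forall>s\<in>U. X (s + h / 2) + X (s - h / 2) = \<eta> * X s + \<beta>"
    unfolding lattice_consts_def by (rule theI'[OF lattice_consts_ex1[OF assms(1)]])
  then show ?thesis using assms(2) unfolding lattice_eta_def lattice_beta_def eb by simp
qed

lemma averaging_ex1:
  assumes "admissible h U X"
  shows "\<exists>!r. \<forall>s\<in>U. poly r (X s) = (poly p (X (s + h / 2)) + poly p (X (s - h / 2))) / 2"
proof (rule ex_ex1I)
  let ?e = "lattice_eta h U X" and ?b = "lattice_beta h U X"
  let ?r = "div_diff h U X ([:0, 1:] * p) - smult (1 / 2) ([:?b, ?e:] * div_diff h U X p)"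
  have "poly ?r (X s) = (poly p (X (s + h / 2)) + poly p (X (s - h / 2))) / 2" if s: "s \<in> U" for s
  proof -
    define z t where "z = X (s - h / 2)" and "t = X (s + h / 2) - X (s - h / 2)"
    have y: "X (s + h / 2) = z + t" and z: "X (s - h / 2) = z" by (simp_all add: z_def t_def)
    have nz: "t \<noteq> 0"
      using assms s unfolding admissible_def parametrising_def t_def by blast
    have eb: "?b + X s * ?e = 2 * z + t"
      using lattice_consts_eq[OF assms s] unfolding y z by (simp add: algebra_simps)
    have d1: "poly (div_diff h U X ([:0, 1:] * p)) (X s) = ((z + t) * poly p (z + t) - z * poly p z) / t"
      using div_diff_eq[OF assms s, of "[:0, 1:] * p"] unfolding y z by simp
    have d2: "poly (div_diff h U X p) (X s) = (poly p (z + t) - poly p z) / t"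
      using div_diff_eq[OF assms s, of p] unfolding y z by simp
    have "poly ?r (X s) = ((z + t) * poly p (z + t) - z * poly p z) / t
        - (1 / 2) * ((?b + X s * ?e) * ((poly p (z + t) - poly p z) / t))"
      by (simp only: poly_diff poly_smult poly_mult[of "[:?b, ?e:]"] d1 d2) simp
    also have "\<dots> = (poly p (z + t) + poly p z) / 2"
      unfolding eb using nz by (simp add: field_simps)
    finally show ?thesis unfolding y z .
  qed
  then show "\<exists>r. \<forall>s\<in>U. poly r (X s) = (poly p (X (s + h / 2)) + poly p (X (s - h / 2))) / 2"
    by blast
next
  fix r r'
  assume r: "\<forall>s\<in>U. poly r (X s) = (poly p (X (s + h / 2)) + poly p (X (s - h / 2))) / 2"
    and r': "\<forall>s\<in>U. poly r' (X s) = (poly p (X (s + h / 2)) + poly p (X (s - h / 2))) / 2"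
  have "infinite (X ` U)" using assms unfolding admissible_def by blast
  then show "r = r'" by (rule poly_eq_on_image) (simp add: r r')
qed

lemma averaging_eq:
  assumes "admissible h U X" "s \<in> U"
  shows "poly (averaging h U X p) (X s) = (poly p (X (s + h / 2)) + poly p (X (s - h / 2))) / 2"
  using theI'[OF averaging_ex1[OF assms(1), of p]] assms(2) unfolding averaging_def by blast

lemma half_root_ex1:
  assumes "\<eta> \<noteq> 0" "q \<noteq> 0" "q + inverse q = \<eta>\<^sup>2 - 2"
  shows "\<exists>!r :: complex. r\<^sup>2 = q \<and> r + inverse r = \<eta>"
proof -
  define w where "w = csqrt q"
  have w: "w\<^sup>2 = q" "w \<noteq> 0" using assms(2) by (auto simp: w_def)
  have "(w + inverse w)\<^sup>2 = w\<^sup>2 + inverse (w\<^sup>2) + 2"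
    using w(2) by (simp add: power2_sum power_inverse)
  then have "(w + inverse w)\<^sup>2 = \<eta>\<^sup>2" using assms(3) w(1) by simp
  then have "w + inverse w = \<eta> \<or> w + inverse w = - \<eta>" by (simp only: power2_eq_iff)
  then consider "w + inverse w = \<eta>" | "w + inverse w = - \<eta>" by blast
  then have ex: "\<exists>r. r\<^sup>2 = q \<and> r + inverse r = \<eta>"
  proof cases
    case 1
    then show ?thesis using w(1) by (intro exI[of _ w]) simp
  next
    case 2
    then have "- (w + inverse w) = \<eta>" by (simp only: minus_minus)
    then show ?thesis using w(1) by (intro exI[of _ "- w"]) simp
  qed
  have uniq: "r = r'"
    if r: "r\<^sup>2 = q" "r + inverse r = \<eta>" and r': "r'\<^sup>2 = q" "r' + inverse r' = \<eta>" for r r' :: complex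
  proof (rule ccontr)
    assume "r \<noteq> r'"
    moreover have "r'\<^sup>2 = r\<^sup>2" using r(1) r'(1) by simp
    ultimately have "r' = - r" unfolding power2_eq_iff by simp
    then have "\<eta> = - (r + inverse r)" using r'(2) by simp
    then have "\<eta> = - \<eta>" unfolding r(2) .
    then show False using assms(1) by simp
  qed
  show ?thesis using ex uniq by blast
qed

lemma half_step_invariant_int:
  assumes "half_step_invariant h U" "s \<in> U"
  shows "s + of_int k * h \<in> U"
proof -
  have 1: "t + h \<in> U" if "t \<in> U" for t
  proof -
    have "t + h / 2 + h / 2 \<in> U" using assms(1) that unfolding half_step_invariant_def by blast
    then show ?thesis by (simp add: add.assoc)
  qed
  have 2: "t - h \<in> U" if "t \<in> U" for t
  proof -
    have "t - h / 2 - h / 2 \<in> U" using assms(1) that unfolding half_step_invariant_def by blast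
    then show ?thesis by (simp add: diff_diff_eq)
  qed
  show ?thesis
  proof (induction k rule: int_induct[of _ 0])
    case base
    show ?case using assms(2) by simp
  next
    case (step1 i)
    then show ?case using 1[of "s + of_int i * h"] by (simp add: algebra_simps)
  next
    case (step2 i)
    then show ?case using 2[of "s + of_int i * h"] by (simp add: algebra_simps)
  qed
qed

lemma linear_recurrence_unique:
  fixes f g :: "int \<Rightarrow> complex"
  assumes f: "\<And>k. f (k + 1) + f (k - 1) = A * f k + B"
    and g: "\<And>k. g (k + 1) + g (k - 1) = A * g k + B"
    and "f 0 = g 0" "f 1 = g 1"
  shows "f k = g k"
proof -
  have "f k = g k \<and> f (k + 1) = g (k + 1)"
  proof (induction k rule: int_induct[of _ 0])
    case base
    show ?case using assms by simp
  next
    case (step1 i)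
    have "f (i + 1 + 1) + f i = g (i + 1 + 1) + g i"
      using f[of "i + 1"] g[of "i + 1"] step1 by simp
    then show ?case using step1 by simp
  next
    case (step2 i)
    have "f (i + 1) + f (i - 1) = g (i + 1) + g (i - 1)"
      unfolding f[of i] g[of i] using step2 by simp
    then have "f (i - 1) = g (i - 1)" using step2 by simp
    then show ?case using step2 by simp
  qed
  then show ?thesis by simp
qed

lemma progression_coeffs_ex1:
  assumes adm: "admissible h U X" and inv: "half_step_invariant h U"
    and br: "q_exponential_branch h U X"
    and eta: "\<eta> = lattice_eta h U X" and beta: "\<beta> = lattice_beta h U X"
    and AB: "A = \<eta>\<^sup>2 - 2" "B = (\<eta> + 2) * \<beta>"
    and q: "q \<noteq> 0" "q + inverse q = A" and c: "c = B / (2 - A)" and s: "s \<in> U"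
  shows "\<exists>!(a, b). \<forall>k::int. X (s + of_int k * h) = a * q powi k + b * q powi (- k) + c"
proof -
  have "\<eta>\<^sup>2 \<noteq> 2\<^sup>2" "\<eta> \<noteq> 0"
    using br unfolding q_exponential_branch_def eta[symmetric] power2_eq_iff by auto
  then have A: "A \<noteq> 2" "A \<noteq> - 2" using AB by auto
  have q1: "q - inverse q \<noteq> 0"
  proof
    assume "q - inverse q = 0"
    then have "q * q = 1" using q(1) by (simp add: field_simps)
    then have "q = 1 \<or> q = - 1" by (metis square_eq_1_iff)
    then show False using q(2) A by auto
  qed
  have half: "X (t + h) + X t = \<eta> * X (t + h / 2) + \<beta>" "X t + X (t - h) = \<eta> * X (t - h / 2) + \<beta>"
    "X (t + h / 2) + X (t - h / 2) = \<eta> * X t + \<beta>" if "t \<in> U" for t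
  proof -
    have u: "t + h / 2 \<in> U" "t - h / 2 \<in> U"
      using inv that unfolding half_step_invariant_def by auto
    have arith: "t + h / 2 + h / 2 = t + h" "t + h / 2 - h / 2 = t"
      "t - h / 2 + h / 2 = t" "t - h / 2 - h / 2 = t - h" by (simp_all add: algebra_simps)
    show "X (t + h) + X t = \<eta> * X (t + h / 2) + \<beta>"
      using lattice_consts_eq[OF adm u(1)] unfolding arith eta beta .
    show "X t + X (t - h) = \<eta> * X (t - h / 2) + \<beta>"
      using lattice_consts_eq[OF adm u(2)] unfolding arith eta beta .
    show "X (t + h / 2) + X (t - h / 2) = \<eta> * X t + \<beta>"
      using lattice_consts_eq[OF adm that] unfolding eta beta .
  qed
  have step: "X (t + h) + X (t - h) = A * X t + B" if t: "t \<in> U" for t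
  proof -
    have "X (t + h) + X (t - h) = (X (t + h) + X t) + (X t + X (t - h)) - 2 * X t" by simp
    then have "X (t + h) + X (t - h) = \<eta> * (X (t + h / 2) + X (t - h / 2)) + 2 * \<beta> - 2 * X t"
      unfolding half(1,2)[OF t] by (simp add: algebra_simps)
    then show ?thesis unfolding half(3)[OF t] AB by (simp add: algebra_simps power2_eq_square)
  qed
  let ?f = "\<lambda>k::int. X (s + of_int k * h)"
  let ?g = "\<lambda>a b (k::int). a * q powi k + b * q powi (- k) + c"
  have f: "?f (k + 1) + ?f (k - 1) = A * ?f k + B" for k
    using step[OF half_step_invariant_int[OF inv s, of k]] by (simp add: algebra_simps)
  have g: "?g a b (k + 1) + ?g a b (k - 1) = A * ?g a b k + B" for a b k
  proof -
    have p: "q powi (k + 1) = q powi k * q" "q powi (k - 1) = q powi k * inverse q"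
      "q powi (- (k + 1)) = q powi (- k) * inverse q" "q powi (- (k - 1)) = q powi (- k) * q"
      using q(1) power_int_add[of q k 1] power_int_add[of q k "- 1"]
        power_int_add[of q "- k" "- 1"] power_int_add[of q "- k" 1]
      by (simp_all add: power_int_minus)
    have "c * (2 - A) = B" using A c by simp
    then have cc: "2 * c = A * c + B" by (simp add: algebra_simps)
    have "?g a b (k + 1) + ?g a b (k - 1)
        = (q + inverse q) * (a * q powi k + b * q powi (- k)) + 2 * c"
      unfolding p by (simp add: algebra_simps)
    then show ?thesis unfolding cc q(2) by (simp add: algebra_simps)
  qed
  define a where "a = (X (s + h) - c - inverse q * (X s - c)) / (q - inverse q)"
  define b where "b = X s - c - a"
  have ab: "?f 0 = ?g a b 0" "?f 1 = ?g a b 1"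
  proof -
    show "?f 0 = ?g a b 0" by (simp add: b_def)
    have "a * (q - inverse q) = X (s + h) - c - inverse q * (X s - c)"
      using q1 by (simp add: a_def)
    then show "?f 1 = ?g a b 1"
      by (simp add: b_def algebra_simps power_int_minus)
  qed
  have ex: "\<forall>k. ?f k = ?g a b k"
    using linear_recurrence_unique[of ?f A B "?g a b", OF f g ab] by blast
  have uniq: "(a', b') = (a, b)" if h: "\<forall>k. ?f k = ?g a' b' k" for a' b'
  proof -
    have 0: "?g a' b' 0 = ?g a b 0" and 1: "?g a' b' 1 = ?g a b 1"
      using h ex by metis+
    have b': "b' - b = - (a' - a)" using 0 by (simp add: algebra_simps)
    have "(a' - a) * q + (b' - b) * inverse q = 0"
      using 1 by (simp add: algebra_simps power_int_minus)
    then have "(a' - a) * (q - inverse q) = 0" unfolding b' by (simp add: algebra_simps)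
    then show ?thesis using q1 b' by simp
  qed
  show ?thesis using ex uniq by (intro ex1I[of _ "(a, b)"]) auto
qed

end

theory Submission
  imports Defs
begin

text \<open>Write the lattice equation as \<open>\<langle>u, T p\<rangle> = 0\<close> for all \<open>p\<close>, where \<open>T p = \<phi> Dp + \<psi> Sp\<close>, and let
  \<open>\<langle>u', p\<rangle> = - \<langle>u, \<phi> Sp + \<psi> ((Y - Z) / 2)\<^sup>2 Dp\<rangle>\<close>. The central identity is
  \<open>\<langle>u', f Dp\<rangle> = \<alpha> \<langle>u, T f p\<rangle>\<close>: up to \<open>\<alpha>\<close>, the raising operator \<open>T\<close> is adjoint to \<open>D\<close>. Moreover \<open>u'\<close>
  satisfies an equation of the same form, whose data \<open>d, e, \<phi>\<^bsup>[n]\<^esup>\<close> are those of \<open>u\<close> shifted by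
  \<open>2, 1, 1\<close>. So the differences of an orthogonal family for \<open>u\<close> are orthogonal for \<open>u'\<close>, and
  \<open>T\<close> lifts an orthogonal family for \<open>u'\<close> to one for \<open>u\<close>; existence and both coefficient
  formulas follow by induction on the degree with \<open>u, \<phi>, \<psi>\<close> varying. If \<open>d\<^sub>n = 0\<close> for a regular
  \<open>u\<close>, then \<open>G = D P\<^bsub>n+1\<^esub>\<close> satisfies \<open>\<phi> DG + \<psi> SG = 0\<close> and \<open>\<phi> SG + \<psi> ((Y - Z) / 2)\<^sup>2 DG = 0\<close>, and the
  determinant \<open>G(Y) G(Z)\<close> of this linear system is not zero, so \<open>\<phi> = \<psi> = 0\<close>.\<close>

section \<open>Orthogonal families\<close>

lemma poly_dual_add: "u \<in> poly_dual \<Longrightarrow> u (p + q) = u p + u q"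
  unfolding poly_dual_def by (simp add: Vector_Spaces.linear_iff)

lemma poly_dual_smult: "u \<in> poly_dual \<Longrightarrow> u (smult k p) = k * u p"
  unfolding poly_dual_def by (simp add: Vector_Spaces.linear_iff)

lemma poly_dual_const_mult: "u \<in> poly_dual \<Longrightarrow> u ([:k:] * p) = k * u p"
  by (simp add: poly_dual_smult)

lemma poly_dual_minus: "u \<in> poly_dual \<Longrightarrow> u (- p) = - u p"
  using poly_dual_smult[of u "-1" p] by simp

lemma poly_dual_diff: "u \<in> poly_dual \<Longrightarrow> u (p - q) = u p - u q"
  using poly_dual_add[of u p "- q"] poly_dual_minus[of u q] by simp

lemma poly_dual_0: "u \<in> poly_dual \<Longrightarrow> u 0 = 0"
  using poly_dual_smult[of u 0 0] by simp

lemmas poly_dual_simps =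
  poly_dual_add poly_dual_smult poly_dual_const_mult poly_dual_minus poly_dual_diff poly_dual_0

lemma degree_diff_cancel_less:
  fixes p q :: "complex poly"
  assumes "degree p \<le> Suc n" "degree q \<le> Suc n" "coeff p (Suc n) = coeff q (Suc n)"
  shows "degree (p - q) \<le> n"
proof (rule degree_le, intro allI impI)
  fix i assume "n < i"
  then consider "i = Suc n" | "Suc n < i" by linarith
  then show "coeff (p - q) i = 0"
    using assms by cases (simp_all add: coeff_eq_0)
qed

lemma coeff_mult_degree_bounds:
  fixes p q :: "'a::comm_semiring_0 poly"
  assumes "degree p \<le> m" "degree q \<le> n"
  shows "coeff (p * q) (m + n) = coeff p m * coeff q n"
proof -
  have "coeff (p * q) (m + n) = (\<Sum>i\<le>m + n. coeff p i * coeff q (m + n - i))"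
    by (rule coeff_mult)
  also have "\<dots> = (\<Sum>i\<in>{m}. coeff p i * coeff q (m + n - i))"
  proof (rule sum.mono_neutral_right)
    show "\<forall>i\<in>{..m + n} - {m}. coeff p i * coeff q (m + n - i) = 0"
    proof
      fix i assume "i \<in> {..m + n} - {m}"
      then have "m < i \<or> n < m + n - i" by auto
      then show "coeff p i * coeff q (m + n - i) = 0" using assms by (auto simp: coeff_eq_0)
    qed
  qed auto
  finally show ?thesis by simp
qed

lemma monic_orthogonal_familyD:
  assumes "monic_orthogonal_family u I P" "n \<in> I"
  shows "degree (P n) = n" "coeff (P n) n = 1" "u (P n * P n) \<noteq> 0"
    "\<And>m. m \<in> I \<Longrightarrow> m \<noteq> n \<Longrightarrow> u (P n * P m) = 0"
proof -
  show *: "degree (P n) = n"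
    using assms unfolding monic_orthogonal_family_def orthogonal_family_def by blast
  have "lead_coeff (P n) = 1"
    using assms unfolding monic_orthogonal_family_def by blast
  then show "coeff (P n) n = 1" unfolding * .
  show "u (P n * P n) \<noteq> 0"
    using assms unfolding monic_orthogonal_family_def orthogonal_family_def
    by (simp add: power2_eq_square)
  fix m assume "m \<in> I" "m \<noteq> n"
  then show "u (P n * P m) = 0"
    using assms unfolding monic_orthogonal_family_def orthogonal_family_def
    by (metis nat_neq_iff mult.commute)
qed

lemma monic_orthogonal_familyI:
  assumes "\<And>n. n \<in> I \<Longrightarrow> degree (P n) = n" "\<And>n. n \<in> I \<Longrightarrow> coeff (P n) n = 1"
    "\<And>n. n \<in> I \<Longrightarrow> u (P n * P n) \<noteq> 0"
    "\<And>m n. m \<in> I \<Longrightarrow> n \<in> I \<Longrightarrow> m < n \<Longrightarrow> u (P n * P m) = 0"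
  shows "monic_orthogonal_family u I P"
  using assms unfolding monic_orthogonal_family_def orthogonal_family_def
  by (auto simp: power2_eq_square)

lemma monic_orthogonal_family_cong:
  assumes "monic_orthogonal_family u I P" "\<And>n. n \<in> I \<Longrightarrow> P' n = P n"
  shows "monic_orthogonal_family u I P'"
  using assms unfolding monic_orthogonal_family_def orthogonal_family_def by auto

lemma monic_orthogonal_family_subset:
  "monic_orthogonal_family u I P \<Longrightarrow> J \<subseteq> I \<Longrightarrow> monic_orthogonal_family u J P"
  unfolding monic_orthogonal_family_def orthogonal_family_def by (auto simp: subset_iff)

lemma monic_orthogonal_family_UNIV:
  "monic_orthogonal_family u UNIV P \<longleftrightarrow> (\<forall>N. monic_orthogonal_family u {0..N + 1} P)"
proof
  assume *: "\<forall>N. monic_orthogonal_family u {0..N + 1} P"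
  show "monic_orthogonal_family u UNIV P"
  proof (rule monic_orthogonal_familyI)
    fix m n :: nat
    assume "m < n"
    then show "u (P n * P m) = 0"
      using monic_orthogonal_familyD(4)[OF *[rule_format, of n], of n m] by simp
  next
    fix n :: nat
    have "n \<in> {0..n + 1}" by simp
    note D = monic_orthogonal_familyD[OF *[rule_format] this]
    show "degree (P n) = n" "coeff (P n) n = 1" "u (P n * P n) \<noteq> 0" by (fact D(1) D(2) D(3))+
  qed
qed (blast intro: monic_orthogonal_family_subset)

section \<open>Orthogonality against arbitrary polynomials and three-term recurrences\<close>

lemma orthogonal_lower_degree:
  assumes u: "u \<in> poly_dual" and P: "monic_orthogonal_family u {0..N} P"
    and n: "n \<le> N" and f: "degree f \<le> m" "m < n"
  shows "u (P n * f) = 0"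
  using f
proof (induction m arbitrary: f)
  case 0
  have P0: "P 0 = 1"
    using monic_orthogonal_familyD(1,2)[OF P, of 0] by (auto elim: degree_eq_zeroE)
  obtain k where "f = [:k:]" using 0 by (auto elim: degree_eq_zeroE)
  moreover have "u (P n * P 0) = 0" using monic_orthogonal_familyD(4)[OF P, of n 0] n 0 by simp
  ultimately show ?case
    using poly_dual_smult[OF u, of k "P n"] P0 by simp
next
  case (Suc m)
  define g where "g = smult (coeff f (Suc m)) (P (Suc m))"
  have PS: "degree (P (Suc m)) = Suc m" "coeff (P (Suc m)) (Suc m) = 1"
    using monic_orthogonal_familyD(1,2)[OF P, of "Suc m"] Suc.prems n by auto
  have "degree (f - g) \<le> m"
    by (rule degree_diff_cancel_less) (use Suc.prems PS in \<open>auto simp: g_def\<close>)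
  then have "u (P n * (f - g)) = 0" using Suc.IH Suc.prems by simp
  moreover have "u (P n * g) = 0"
    using monic_orthogonal_familyD(4)[OF P, of n "Suc m"] Suc.prems n
    by (simp add: g_def poly_dual_smult[OF u])
  ultimately show ?case by (simp add: right_diff_distrib poly_dual_diff[OF u])
qed

lemma orthogonal_same_degree:
  assumes u: "u \<in> poly_dual" and P: "monic_orthogonal_family u {0..N} P"
    and n: "n \<le> N" and f: "degree f \<le> n"
  shows "u (P n * f) = coeff f n * u (P n * P n)"
proof (cases n)
  case 0
  then obtain k where "f = [:k:]" using f by (auto elim: degree_eq_zeroE)
  moreover have "P 0 = 1"
    using monic_orthogonal_familyD(1,2)[OF P, of 0] by (auto elim: degree_eq_zeroE)
  ultimately show ?thesis using poly_dual_smult[OF u, of k 1] 0 by simp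
next
  case (Suc m)
  define g where "g = smult (coeff f n) (P n)"
  have "degree (f - g) \<le> m"
    by (rule degree_diff_cancel_less)
      (use f Suc n monic_orthogonal_familyD(1,2)[OF P, of n] in \<open>auto simp: g_def\<close>)
  then have "u (P n * (f - g)) = 0" using orthogonal_lower_degree[OF u P n] Suc by simp
  then show ?thesis by (simp add: right_diff_distrib poly_dual_simps[OF u] g_def)
qed

text \<open>Pairing \<open>g\<close> with the member of its own degree gives its leading coefficient
  times a nonzero norm. Polynomial identities are deduced from orthogonality in this way
  below.\<close>

lemma orthogonal_nondegenerate:
  assumes u: "u \<in> poly_dual" and P: "monic_orthogonal_family u {0..N} P"
    and g: "degree g \<le> N" "\<And>i. i \<le> degree g \<Longrightarrow> u (P i * g) = 0"
  shows "g = 0"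
proof -
  have "u (P (degree g) * g) = lead_coeff g * u (P (degree g) * P (degree g))"
    by (rule orthogonal_same_degree[OF u P g(1)]) simp
  then show ?thesis
    using g monic_orthogonal_familyD(3)[OF P, of "degree g"] by auto
qed

text \<open>The two conditions on \<open>b\<close> and \<open>k\<close> are supplied later by second
  coefficients and norm ratios. They give the residual \<open>R\<close> degree at most
  \<open>m\<close> and make it orthogonal to \<open>P 0\<close>, ..., \<open>P m\<close>, so
  nondegeneracy forces it to vanish.\<close>

lemma orthogonal_three_term:
  assumes u: "u \<in> poly_dual" and P: "monic_orthogonal_family u {0..N} P" and m: "m + 2 \<le> N"
    and b: "degree (P (m + 2) - [:- b, 1:] * P (m + 1)) \<le> m"
    and k: "u (P (m + 1) * P (m + 1)) = k * u (P m * P m)"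
  shows "P (m + 2) = [:- b, 1:] * P (m + 1) - smult k (P m)"
proof -
  define R where "R = P (m + 2) - [:- b, 1:] * P (m + 1) + smult k (P m)"
  have dm: "degree (P m) = m" using monic_orthogonal_familyD(1)[OF P, of m] m by simp
  have "degree R \<le> m"
    unfolding R_def using b dm by (intro degree_add_le) (auto intro: order_trans[OF degree_smult_le])
  moreover have "u (P i * R) = 0" if i: "i \<le> m" for i
  proof -
    have di: "degree (P i) = i" "coeff (P i) i = 1"
      using monic_orthogonal_familyD(1,2)[OF P, of i] i m by auto
    have 1: "u (P (m + 2) * P i) = 0" "u (P (m + 1) * P i) = 0"
      using monic_orthogonal_familyD(4)[OF P, of "m + 2" i]
        monic_orthogonal_familyD(4)[OF P, of "m + 1" i] i m by auto
    have dx: "degree ([:0, 1:] * P i) \<le> i + 1" "coeff ([:0, 1:] * P i) (i + 1) = 1"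
      using di degree_pCons_le[of 0 "P i"] by auto
    \<comment> \<open>With \<open>x\<close> moved to the other factor, \<open>P i\<close> becomes a
      monic polynomial of degree \<open>i + 1\<close>, so only \<open>i = m\<close> can
      contribute.\<close>
    have x: "u (P (m + 1) * ([:0, 1:] * P i)) = (if i = m then u (P (m + 1) * P (m + 1)) else 0)"
    proof (cases "i = m")
      case True
      then show ?thesis
        using orthogonal_same_degree[OF u P, of "m + 1" "[:0, 1:] * P i"] dx m by simp
    next
      case False
      then show ?thesis
        using orthogonal_lower_degree[OF u P, of "m + 1" "[:0, 1:] * P i" "i + 1"] dx i m by simp
    qed
    have y: "k * u (P i * P m) = (if i = m then u (P (m + 1) * P (m + 1)) else 0)"
      using k monic_orthogonal_familyD(4)[OF P, of i m] i m by auto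
    have "P i * R = P (m + 2) * P i - P (m + 1) * ([:0, 1:] * P i) + smult b (P (m + 1) * P i)
        + smult k (P i * P m)"
      unfolding R_def by (simp add: algebra_simps)
    then show ?thesis using 1 x y by (simp add: poly_dual_simps[OF u])
  qed
  ultimately have "R = 0"
    using orthogonal_nondegenerate[OF u P, of R] m by auto
  then show ?thesis unfolding R_def by (simp add: algebra_simps)
qed

lemma three_term_recurrence_unique:
  assumes "three_term_recurrence {0..N} B C P" "three_term_recurrence {0..N} B C P'" "n \<le> N + 1"
  shows "P n = P' n"
  using assms(3)
proof (induction n rule: less_induct)
  case (less n)
  show ?case
  proof (cases n)
    case 0
    then show ?thesis using assms unfolding three_term_recurrence_def by simp
  next
    case (Suc m)
    \<comment> \<open>For \<open>m = 0\<close> truncated subtraction turns \<open>P (m - 1)\<close>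
      into \<open>P 0\<close>; this is harmless because the recurrence drops that term.\<close>
    then have "m \<in> {0..N}" "P m = P' m" "P (m - 1) = P' (m - 1)" using less by auto
    then show ?thesis using assms Suc unfolding three_term_recurrence_def by simp
  qed
qed

lemma three_term_recurrence_UNIV:
  "three_term_recurrence UNIV B C P \<longleftrightarrow> (\<forall>N. three_term_recurrence {0..N} B C P)"
proof -
  have "(\<forall>n\<in>UNIV. R n) \<longleftrightarrow> (\<forall>N. \<forall>n\<in>{0..N}. R n)" for R :: "nat \<Rightarrow> bool"
  proof
    assume *: "\<forall>N. \<forall>n\<in>{0..N}. R n"
    show "\<forall>n\<in>UNIV. R n" using *[rule_format, of n n for n] by auto
  qed simp
  then show ?thesis unfolding three_term_recurrence_def by (simp only: all_simps)
qed

lemma three_term_recurrence_exists: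
  "\<exists>P. three_term_recurrence K B C P"
proof -
  \<comment> \<open>The pair \<open>F n\<close> carries two consecutive members; the initial 0 plays
    the part of the void member of index -1.\<close>
  define F :: "nat \<Rightarrow> complex poly \<times> complex poly" where
    "F = rec_nat (0, 1) (\<lambda>n (p, p'). (p', [:- B n, 1:] * p' - (if n = 0 then 0 else smult (C n) p)))"
  have F: "F 0 = (0, 1)" "F (Suc n) = (snd (F n),
      [:- B n, 1:] * snd (F n) - (if n = 0 then 0 else smult (C n) (fst (F n))))" for n
    by (simp_all add: F_def split: prod.split)
  have "fst (F (Suc n)) = snd (F n)" for n by (simp add: F)
  then have "fst (F n) = snd (F (n - 1))" if "n \<noteq> 0" for n using that by (cases n) auto
  then have "three_term_recurrence K B C (\<lambda>n. snd (F n))"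
    unfolding three_term_recurrence_def by (auto simp: F simp del: mult_pCons_left)
  then show ?thesis by blast
qed

section \<open>Abstract calculus of the divided-difference and averaging operators\<close>

text \<open>Only these rules of the operators enter the argument; points of the lattice reappear
  when the locale is interpreted. There \<open>r\<close> is the half-step-compatible root of
  \<open>q\<close>, \<open>\<omega>\<close> is the product of the progression coefficients, and
  \<open>r_sum_nonzero\<close> says that \<eta> is not 0.\<close>

locale lattice_calculus =
  fixes D S :: "complex poly \<Rightarrow> complex poly" and r c \<omega> :: complex
  assumes D_add: "D (f + g) = D f + D g" and S_add: "S (f + g) = S f + S g"
    and D_const: "D [:k:] = 0" and S_const: "S [:k:] = [:k:]"
    and D_shift': "D [:- c, 1:] = 1" and S_shift': "S [:- c, 1:] = [:(r + inverse r) / 2:] * [:- c, 1:]"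
    and D_mult: "D (f * g) = D f * S g + S f * D g"
    and S_mult': "S (f * g) = [:((r + inverse r) / 2)\<^sup>2 - 1:] * ([:- c, 1:]\<^sup>2 - [:4 * \<omega>:]) * D f * D g + S f * S g"
    and r_nonzero: "r \<noteq> 0" and r_generic: "n > 0 \<Longrightarrow> r ^ (2 * n) \<noteq> 1"
    and r_sum_nonzero: "r + inverse r \<noteq> 0"
begin

text \<open>With r = exp t these are cosh (n t) and sinh (n t) / sinh t, while
  \<open>\<alpha>\<^sup>2 - 1\<close> is the square of sinh t. The relations proved below are the
  hyperbolic addition theorems.\<close>

definition al :: "nat \<Rightarrow> complex" where "al n = (r ^ n + inverse r ^ n) / 2"
definition ga :: "nat \<Rightarrow> complex" where "ga n = (r ^ n - inverse r ^ n) / (r - inverse r)"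

definition \<alpha> :: complex where "\<alpha> = (r + inverse r) / 2"
definition \<xi> :: "complex poly" where "\<xi> = [:- c, 1:]"

text \<open>In terms of the lattice, \<open>V (X) = ((Y - Z) / 2)\<^sup>2\<close>.\<close>

definition V :: "complex poly" where "V = [:\<alpha>\<^sup>2 - 1:] * (\<xi>\<^sup>2 - [:4 * \<omega>:])"
text \<open>This is the correction term in the commutation laws of \<open>D\<close> and
  \<open>S\<close>; also \<open>D V\<close> equals 2 \<alpha> \<open>W\<close>.\<close>

definition W :: "complex poly" where "W = [:\<alpha>\<^sup>2 - 1:] * \<xi>"

lemma S_mult: "S (f * g) = V * D f * D g + S f * S g"
  unfolding V_def \<alpha>_def \<xi>_def by (rule S_mult')

lemma D_shift: "D \<xi> = 1" and S_shift: "S \<xi> = [:\<alpha>:] * \<xi>"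
  unfolding \<xi>_def \<alpha>_def by (rule D_shift' S_shift')+

lemma r_diff_nonzero: "r - inverse r \<noteq> 0"
proof
  assume "r - inverse r = 0"
  then have "r ^ (2 * 1) = 1" using r_nonzero by (simp add: field_simps power2_eq_square)
  then show False using r_generic[of 1] by simp
qed

lemma alpha_square: "\<alpha>\<^sup>2 - 1 = ((r - inverse r) / 2)\<^sup>2"
  using r_nonzero by (simp add: \<alpha>_def field_simps power2_eq_square)

lemma al_0 [simp]: "al 0 = 1" and ga_0 [simp]: "ga 0 = 0"
  and al_1 [simp]: "al (Suc 0) = \<alpha>" and ga_1 [simp]: "ga (Suc 0) = 1"
  using r_diff_nonzero by (simp_all add: al_def ga_def \<alpha>_def)

lemma al_Suc: "al (Suc n) = \<alpha> * al n + (\<alpha>\<^sup>2 - 1) * ga n"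
  and ga_Suc: "ga (Suc n) = \<alpha> * ga n + al n"
proof -
  \<comment> \<open>Expressing \<open>r ^ n\<close> as \<open>y + w * g\<close> removes the quotient
    hidden in \<open>ga n\<close>, and only powers of \<open>w\<close> remain to be
    cancelled.\<close>
  define t w y g where "t = inverse r" and "w = r - t" and "y = t ^ n" and "g = ga n"
  have nz: "w \<noteq> 0" using r_diff_nonzero by (simp add: w_def t_def)
  have r: "r = t + w" by (simp add: w_def)
  have "g = (r ^ n - y) / w" by (simp add: g_def ga_def y_def t_def w_def)
  then have x: "r ^ n = y + w * g" using nz by simp
  have sq: "\<alpha>\<^sup>2 - 1 = (w / 2)\<^sup>2" unfolding alpha_square w_def t_def ..
  have n: "al n = (y + w * g + y) / 2"
    and Suc: "al (Suc n) = ((t + w) * (y + w * g) + t * y) / 2"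
      "ga (Suc n) = ((t + w) * (y + w * g) - t * y) / w"
    and a: "\<alpha> = (t + w + t) / 2"
    unfolding al_def ga_def \<alpha>_def power_Suc x[symmetric] r[symmetric] unfolding y_def t_def w_def by simp_all
  show "al (Suc n) = \<alpha> * al n + (\<alpha>\<^sup>2 - 1) * ga n"
    unfolding sq unfolding n Suc a g_def[symmetric] by (simp add: field_simps power2_eq_square)
  show "ga (Suc n) = \<alpha> * ga n + al n"
    unfolding n Suc a g_def[symmetric] using nz by (simp add: field_simps)
qed

lemma al_ga_pythagoras: "(al n)\<^sup>2 - (\<alpha>\<^sup>2 - 1) * (ga n)\<^sup>2 = 1"
proof (induction n)
  case (Suc n)
  have "(al (Suc n))\<^sup>2 - (\<alpha>\<^sup>2 - 1) * (ga (Suc n))\<^sup>2 = (al n)\<^sup>2 - (\<alpha>\<^sup>2 - 1) * (ga n)\<^sup>2"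
    unfolding al_Suc ga_Suc by algebra
  then show ?case using Suc by simp
qed simp

lemma ga_nonzero: "n > 0 \<Longrightarrow> ga n \<noteq> 0"
proof
  assume n: "n > 0" and "ga n = 0"
  then have "r ^ n = inverse r ^ n" using r_diff_nonzero by (simp add: ga_def)
  then have "r ^ n * r ^ n = 1" using r_nonzero by (metis power_inverse power_not_zero right_inverse)
  then show False using r_generic[OF n] by (simp add: mult_2 power_add)
qed

lemma alpha_nonzero: "\<alpha> \<noteq> 0"
  using r_sum_nonzero by (simp add: \<alpha>_def)

section \<open>Product rules and commutation laws\<close>

lemma D_0: "D 0 = 0" and S_0: "S 0 = 0"
  using D_const[of 0] S_const[of 0] by simp_all

lemma D_1: "D 1 = 0" and S_1: "S 1 = 1"
  using D_const[of 1] S_const[of 1] by (simp_all add: one_pCons)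

lemma D_const_mult: "D ([:k:] * f) = [:k:] * D f"
  unfolding D_mult D_const S_const by simp

lemma S_const_mult: "S ([:k:] * f) = [:k:] * S f"
  unfolding S_mult D_const S_const by simp

lemma D_smult: "D (smult k f) = smult k (D f)" and S_smult: "S (smult k f) = smult k (S f)"
  using D_const_mult[of k f] S_const_mult[of k f] by simp_all

lemma D_diff: "D (f - g) = D f - D g" and S_diff: "S (f - g) = S f - S g"
  using D_add[of "f - g" g] S_add[of "f - g" g] by (simp_all add: algebra_simps)

lemma D_shift_mult: "D (\<xi> * f) = [:\<alpha>:] * \<xi> * D f + S f"
  and S_shift_mult: "S (\<xi> * f) = V * D f + [:\<alpha>:] * \<xi> * S f"
  unfolding D_mult S_mult D_shift S_shift by (simp_all only: mult_1_left mult_1_right) (simp add: add.commute)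

text \<open>Horner's scheme in powers of x - c. It suits the operators because
  \<open>D_shift_mult\<close> and \<open>S_shift_mult\<close> express their values at
  \<open>\<xi> * f\<close> through \<open>D f\<close> and \<open>S f\<close>.\<close>

lemma shift_induct [case_names const shift]:
  assumes "\<And>k. P [:k:]" "\<And>k p. P p \<Longrightarrow> P ([:k:] + \<xi> * p)"
  shows "P p"
proof (induction "degree p" arbitrary: p)
  case 0
  then show ?case using assms(1) by (metis degree_eq_zeroE)
next
  case (Suc n)
  have "p = [:poly p c:] + \<xi> * synthetic_div p c"
    using synthetic_div_correct'[of c p] by (simp add: add.commute \<xi>_def)
  moreover have "degree (synthetic_div p c) = n" using Suc(2) by (simp add: degree_synthetic_div)
  ultimately show ?case using assms(2) Suc(1) by metis
qed

lemma V_eq: "V = [:\<alpha>\<^sup>2 - 1:] * (\<xi> * \<xi>) - [:(\<alpha>\<^sup>2 - 1) * 4 * \<omega>:]"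
proof -
  have "[:\<alpha>\<^sup>2 - 1:] * [:4 * \<omega>:] = [:(\<alpha>\<^sup>2 - 1) * 4 * \<omega>:]" by simp
  then show ?thesis unfolding V_def by (simp only: right_diff_distrib power2_eq_square)
qed

lemma D_V: "D V = [:\<alpha>\<^sup>2 - 1:] * [:2 * \<alpha>:] * \<xi>"
proof -
  have 2: "[:2 * \<alpha>:] = [:\<alpha>:] + [:\<alpha>:]" by simp
  show ?thesis
    unfolding V_eq D_diff D_const D_const_mult D_shift_mult D_shift S_shift 2 by algebra
qed

lemma S_V: "S V = [:\<alpha>\<^sup>2 - 1:] * (V + [:\<alpha>:] * [:\<alpha>:] * \<xi> * \<xi> - \<xi> * \<xi>) + V"
  unfolding V_eq S_diff S_const S_const_mult S_shift_mult D_shift S_shift by algebra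

text \<open>Splitting constants into ring expressions in \<open>[:\<alpha>:]\<close> turns the
  operator laws into identities of a commutative ring.\<close>

lemma alpha_poly: "[:\<alpha>\<^sup>2 - 1:] = [:\<alpha>:] * [:\<alpha>:] - 1"
  by (simp add: power2_eq_square one_pCons)

text \<open>Both laws are proved in one induction because passing from \<open>p\<close> to
  \<open>\<xi> * p\<close> mixes \<open>D (S p)\<close> with \<open>S (S p)\<close>.\<close>

lemma D_S_and_S_S:
  "D (S f) = [:\<alpha>:] * S (D f) + W * D (D f) \<and> S (S f) = W * S (D f) + [:\<alpha>:] * V * D (D f) + f"
proof (induction f rule: shift_induct)
  case (const k)
  then show ?case by (simp add: D_const S_const D_0 S_0)
next
  case (shift k p)
  have aa: "[:2 * \<alpha>:] = [:\<alpha>:] + [:\<alpha>:]" by simp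
  note simps = D_add S_add D_const S_const D_shift_mult S_shift_mult D_mult[of V] S_mult[of V] D_const_mult
    S_const_mult mult.assoc D_V S_V D_0 S_0
  have IH: "D (S p) = [:\<alpha>:] * S (D p) + W * D (D p)"
    "S (S p) = W * S (D p) + [:\<alpha>:] * V * D (D p) + p" using shift by auto
  show ?case
    unfolding simps IH unfolding aa W_def alpha_poly by (intro conjI; algebra)
qed

lemmas D_S = D_S_and_S_S[THEN conjunct1] and S_S = D_S_and_S_S[THEN conjunct2]

definition raise_op :: "complex poly \<Rightarrow> complex poly \<Rightarrow> complex poly \<Rightarrow> complex poly" where
  "raise_op \<phi> \<psi> f = \<phi> * D f + \<psi> * S f"

text \<open>This is the second coefficient in the product rule: \<open>raise_op\<close> of
  \<open>f * g\<close> is \<open>raise_op\<close> of \<open>f\<close> times \<open>S g\<close> plus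
  \<open>companion_op\<close> of \<open>f\<close> times \<open>D g\<close>.\<close>

definition companion_op :: "complex poly \<Rightarrow> complex poly \<Rightarrow> complex poly \<Rightarrow> complex poly" where
  "companion_op \<phi> \<psi> f = \<phi> * S f + \<psi> * V * D f"

text \<open>For g = \<alpha> S p - W D p the commutation laws collapse to D g = S (D p) and S g = V
  D (D p) + \<alpha> p, and the product rules of both operators then agree. Under a functional that
  vanishes on the range of \<open>raise_op\<close>, the right-hand side disappears.\<close>

lemma companion_op_mult_D: "companion_op \<phi> \<psi> (f * D p) + [:\<alpha>:] * raise_op \<phi> \<psi> f * p = raise_op \<phi> \<psi> (f * ([:\<alpha>:] * S p - W * D p))"
proof -
  have 1: "D ([:\<alpha>:] * S p - W * D p) = S (D p)"
    unfolding D_diff D_const_mult W_def mult.assoc D_shift_mult D_S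
    unfolding W_def alpha_poly by (simp add: algebra_simps smult_diff_right)
  have 2: "S ([:\<alpha>:] * S p - W * D p) = V * D (D p) + [:\<alpha>:] * p"
    unfolding S_diff S_const_mult W_def mult.assoc S_shift_mult S_S unfolding W_def alpha_poly by algebra
  show ?thesis
    unfolding raise_op_def companion_op_def D_mult[of f] S_mult[of f] 1 2 by algebra
qed

text \<open>The same device with g = \<alpha> V D p - W S p, for which D g = S (S p) - \<alpha>^2 p
  and S g = V D (S p) - \<alpha> W p. It treats the averaging term in the equation of the derived
  functional.\<close>

lemma companion_op_mult_S: "companion_op \<phi> \<psi> (f * S p) - [:\<alpha>:] * ([:\<alpha>:] * companion_op \<phi> \<psi> f + W * raise_op \<phi> \<psi> f) * p
    = raise_op \<phi> \<psi> (f * ([:\<alpha>:] * (V * D p) - W * S p))"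
proof -
  have aa: "[:2 * \<alpha>:] = [:\<alpha>:] + [:\<alpha>:]" by simp
  have 1: "D ([:\<alpha>:] * (V * D p) - W * S p) = S (S p) - [:\<alpha>:] * [:\<alpha>:] * p"
    unfolding D_diff D_const_mult W_def mult.assoc D_shift_mult D_mult[of V] D_V S_V D_S S_S
    unfolding aa W_def alpha_poly by algebra
  have 2: "S ([:\<alpha>:] * (V * D p) - W * S p) = V * D (S p) - [:\<alpha>:] * W * p"
    unfolding S_diff S_const_mult W_def mult.assoc S_shift_mult S_mult[of V] D_V S_V D_S S_S
    unfolding aa W_def alpha_poly by algebra
  show ?thesis
    unfolding raise_op_def companion_op_def D_mult[of f] S_mult[of f] 1 2 by algebra
qed

subsection \<open>Action on coefficients\<close>

text \<open>Coefficients in powers of x - c. \<open>D\<close> reverses and \<open>S\<close>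
  preserves parity in x - c, so in this basis the second coefficient evolves independently of the
  leading one.\<close>

definition centred_coeff :: "complex poly \<Rightarrow> nat \<Rightarrow> complex" where
  "centred_coeff p i = coeff (pcompose p [:c, 1:]) i"

lemma centred_coeff_add: "centred_coeff (p + q) i = centred_coeff p i + centred_coeff q i"
  and centred_coeff_diff: "centred_coeff (p - q) i = centred_coeff p i - centred_coeff q i"
  and centred_coeff_smult: "centred_coeff (smult k p) i = k * centred_coeff p i"
  and centred_coeff_const: "centred_coeff [:k:] i = (if i = 0 then k else 0)"
  and centred_coeff_0 [simp]: "centred_coeff 0 i = 0"
  by (auto simp: centred_coeff_def pcompose_add pcompose_diff pcompose_smult coeff_pCons split: nat.split)

lemma centred_coeff_const_mult: "centred_coeff ([:k:] * p) i = k * centred_coeff p i"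
  using centred_coeff_smult[of k p] by simp

lemma pcompose_shift_mult: "pcompose (\<xi> * p) [:c, 1:] = pCons 0 (pcompose p [:c, 1:])"
  unfolding \<xi>_def pcompose_mult by (simp add: pcompose_pCons)

lemma centred_coeff_shift_mult_0 [simp]: "centred_coeff (\<xi> * p) 0 = 0"
  and centred_coeff_shift_mult_Suc [simp]: "centred_coeff (\<xi> * p) (Suc i) = centred_coeff p i"
  unfolding centred_coeff_def pcompose_shift_mult by simp_all

lemma centred_coeff_shift: "centred_coeff \<xi> i = (if i = 1 then 1 else 0)"
  by (simp add: centred_coeff_def \<xi>_def pcompose_pCons coeff_pCons split: nat.split)

lemma centred_coeff_eq_0: "degree p < i \<Longrightarrow> centred_coeff p i = 0"
  unfolding centred_coeff_def by (rule coeff_eq_0) (simp add: degree_pcompose)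

lemma centred_coeff_degree_le: "(\<And>i. i > n \<Longrightarrow> centred_coeff p i = 0) \<Longrightarrow> degree p \<le> n"
  using degree_le[of n "pcompose p [:c, 1:]"] by (simp add: centred_coeff_def degree_pcompose)

lemma centred_coeff_top: "degree p \<le> n \<Longrightarrow> centred_coeff p n = coeff p n"
  using lead_coeff_comp[of "[:c, 1:]" p] centred_coeff_eq_0[of p n] coeff_eq_0[of p n]
  by (cases "degree p = n") (auto simp: centred_coeff_def degree_pcompose)

lemma centred_coeff_inject:
  assumes "\<And>i. centred_coeff p i = centred_coeff q i"
  shows "p = q"
proof -
  have "pcompose (p - q) [:c, 1:] = 0"
    using assms by (intro poly_eqI) (simp add: centred_coeff_def pcompose_diff)
  then show ?thesis using pcompose_eq_0[of "p - q" "[:c, 1:]"] by simp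
qed

lemma centred_coeff_V_mult:
  "centred_coeff (V * p) (Suc (Suc i)) = (\<alpha>\<^sup>2 - 1) * (centred_coeff p i - 4 * \<omega> * centred_coeff p (Suc (Suc i)))"
  "centred_coeff (V * p) (Suc 0) = - 4 * (\<alpha>\<^sup>2 - 1) * \<omega> * centred_coeff p (Suc 0)"
  "centred_coeff (V * p) 0 = - 4 * (\<alpha>\<^sup>2 - 1) * \<omega> * centred_coeff p 0"
proof -
  have "V * p = [:\<alpha>\<^sup>2 - 1:] * (\<xi> * (\<xi> * p)) - [:(\<alpha>\<^sup>2 - 1) * 4 * \<omega>:] * p"
    unfolding V_eq by algebra
  then have *: "centred_coeff (V * p) i = (\<alpha>\<^sup>2 - 1) * centred_coeff (\<xi> * (\<xi> * p)) i - (\<alpha>\<^sup>2 - 1) * 4 * \<omega> * centred_coeff p i" for i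
    by (simp only: centred_coeff_diff centred_coeff_const_mult)
  show "centred_coeff (V * p) (Suc (Suc i)) = (\<alpha>\<^sup>2 - 1) * (centred_coeff p i - 4 * \<omega> * centred_coeff p (Suc (Suc i)))"
    "centred_coeff (V * p) (Suc 0) = - 4 * (\<alpha>\<^sup>2 - 1) * \<omega> * centred_coeff p (Suc 0)"
    "centred_coeff (V * p) 0 = - 4 * (\<alpha>\<^sup>2 - 1) * \<omega> * centred_coeff p 0"
    unfolding * by (simp_all add: ring_distribs)
qed

lemma shift_decompose:
  obtains k p' where "p = [:k:] + \<xi> * p'"
proof
  show "p = [:poly p c:] + \<xi> * synthetic_div p c"
    using synthetic_div_correct'[of c p] by (simp add: add.commute \<xi>_def)
qed

text \<open>Peeling off one factor \<open>\<xi>\<close> makes the two top coefficients obey the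
  recurrences \<open>al_Suc\<close> and \<open>ga_Suc\<close>. The second coefficient is tracked for
  the sake of B_n. The last conjunct is guarded because \<open>D p\<close> has a coefficient of
  index n - 1 only for n > 0.\<close>

lemma D_S_centred_coeff:
  assumes "\<And>i. i > Suc n \<Longrightarrow> centred_coeff p i = 0"
  shows "(\<forall>i > Suc n. centred_coeff (S p) i = 0) \<and> (\<forall>i > n. centred_coeff (D p) i = 0) \<and>
    centred_coeff (S p) (Suc n) = al (Suc n) * centred_coeff p (Suc n) \<and> centred_coeff (S p) n = al n * centred_coeff p n \<and>
    centred_coeff (D p) n = ga (Suc n) * centred_coeff p (Suc n) \<and> (\<forall>m. n = Suc m \<longrightarrow> centred_coeff (D p) m = ga n * centred_coeff p n)"
  using assms
proof (induction n arbitrary: p)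
  case 0
  obtain k p' where p: "p = [:k:] + \<xi> * p'" by (rule shift_decompose)
  have cfp: "centred_coeff p (Suc i) = centred_coeff p' i" for i unfolding p by (simp add: centred_coeff_add centred_coeff_const)
  have "degree p' \<le> 0"
  proof (rule centred_coeff_degree_le)
    fix i :: nat assume "i > 0"
    then show "centred_coeff p' i = 0" using 0[of "Suc i"] cfp by simp
  qed
  then obtain l where p': "p' = [:l:]" by (auto elim: degree_eq_zeroE)
  have pl: "p = [:k:] + smult l \<xi>" unfolding p p' by simp
  have "D p = [:l:]" "S p = [:k:] + smult (l * \<alpha>) \<xi>"
    unfolding pl D_add S_add D_const S_const D_smult S_smult D_shift S_shift by simp_all
  moreover have "centred_coeff p 0 = k" "centred_coeff p (Suc 0) = l"
    unfolding pl centred_coeff_add centred_coeff_smult centred_coeff_const centred_coeff_shift by simp_all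
  moreover have "centred_coeff ([:k:] + smult m \<xi>) i = (if i = 0 then k else if i = 1 then m else 0)" for m i
    unfolding centred_coeff_add centred_coeff_smult centred_coeff_const centred_coeff_shift by simp
  ultimately show ?case by (simp add: centred_coeff_const)
next
  case (Suc n)
  obtain k p' where p: "p = [:k:] + \<xi> * p'" by (rule shift_decompose)
  have cfp: "centred_coeff p (Suc i) = centred_coeff p' i" for i unfolding p by (simp add: centred_coeff_add centred_coeff_const)
  have "centred_coeff p' i = 0" if "i > Suc n" for i using Suc.prems[of "Suc i"] that by (simp add: cfp)
  note IH = Suc.IH[OF this]
  have Dp: "centred_coeff (D p) (Suc i) = \<alpha> * centred_coeff (D p') i + centred_coeff (S p') (Suc i)" for i
    unfolding p D_add D_const D_shift_mult mult.assoc centred_coeff_add centred_coeff_const_mult by simp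
  have D0: "centred_coeff (D p) 0 = centred_coeff (S p') 0"
    unfolding p D_add D_const D_shift_mult mult.assoc centred_coeff_add centred_coeff_const_mult by simp
  have Sp: "centred_coeff (S p) (Suc i) = centred_coeff (V * D p') (Suc i) + \<alpha> * centred_coeff (S p') i" for i
    unfolding p S_add S_const S_shift_mult mult.assoc centred_coeff_add centred_coeff_const_mult by (simp add: centred_coeff_const)
  have S: "centred_coeff (S p) i = 0" if "i > Suc (Suc n)" for i
  proof -
    have "i = Suc (Suc (i - 2))" "i - 2 > n" using that by simp_all
    then obtain j where "i = Suc (Suc j)" "j > n" by blast
    then show ?thesis using IH by (simp add: Sp centred_coeff_V_mult)
  qed
  have D: "centred_coeff (D p) i = 0" if "i > Suc n" for i
  proof -
    have "i = Suc (i - 1)" "i - 1 > n" using that by simp_all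
    then obtain j where "i = Suc j" "j > n" by blast
    then show ?thesis using IH by (simp add: Dp)
  qed
  have 1: "centred_coeff (S p) (Suc (Suc n)) = al (Suc (Suc n)) * centred_coeff p (Suc (Suc n))"
    unfolding Sp centred_coeff_V_mult cfp al_Suc[of "Suc n"] using IH by (simp add: algebra_simps)
  have 2: "centred_coeff (D p) (Suc n) = ga (Suc (Suc n)) * centred_coeff p (Suc (Suc n))"
    using IH by (simp add: Dp cfp ga_Suc[of "Suc n"] algebra_simps)
  have 3: "centred_coeff (S p) (Suc n) = al (Suc n) * centred_coeff p (Suc n) \<and> centred_coeff (D p) n = ga (Suc n) * centred_coeff p (Suc n)"
  proof (cases n)
    case 0
    then show ?thesis using IH by (simp add: Sp D0 centred_coeff_V_mult cfp)
  next
    case (Suc m)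
    have "centred_coeff (D p') m = ga n * centred_coeff p' n" "centred_coeff (D p') (Suc n) = 0" "centred_coeff (S p') n = al n * centred_coeff p' n"
      using IH Suc by auto
    then show ?thesis
      unfolding al_Suc[of n] ga_Suc[of n] unfolding Suc Sp Dp centred_coeff_V_mult cfp by (simp add: algebra_simps)
  qed
  show ?case by (intro conjI allI impI) (use S D 1 2 3 in simp_all)
qed

lemma degree_D_le: "degree p \<le> Suc n \<Longrightarrow> degree (D p) \<le> n"
  and centred_coeff_D_top: "degree p \<le> Suc n \<Longrightarrow> centred_coeff (D p) n = ga (Suc n) * centred_coeff p (Suc n)"
  and centred_coeff_D_second: "degree p \<le> Suc (Suc m) \<Longrightarrow> centred_coeff (D p) m = ga (Suc m) * centred_coeff p (Suc m)"
  using D_S_centred_coeff[of n p] D_S_centred_coeff[of "Suc m" p] centred_coeff_eq_0[of p] by (auto intro!: centred_coeff_degree_le)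

lemma degree_S_le: "degree p \<le> n \<Longrightarrow> degree (S p) \<le> n"
  and centred_coeff_S_top: "degree p \<le> n \<Longrightarrow> centred_coeff (S p) n = al n * centred_coeff p n"
proof -
  assume p: "degree p \<le> n"
  have "degree (S p) \<le> n \<and> centred_coeff (S p) n = al n * centred_coeff p n"
  proof (cases n)
    case 0
    then obtain k where "p = [:k:]" using p by (auto elim: degree_eq_zeroE)
    then show ?thesis by (simp add: S_const 0)
  next
    case (Suc m)
    then show ?thesis using D_S_centred_coeff[of m p] centred_coeff_eq_0[of p] p by (auto intro!: centred_coeff_degree_le)
  qed
  then show "degree (S p) \<le> n" "centred_coeff (S p) n = al n * centred_coeff p n" by auto
qed

lemma coeff_D_top: "degree p \<le> Suc n \<Longrightarrow> coeff (D p) n = ga (Suc n) * coeff p (Suc n)"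
  using centred_coeff_D_top[of p n] centred_coeff_top[of "D p" n] centred_coeff_top[of p "Suc n"] degree_D_le[of p n] by simp

lemma coeff_S_top: "degree p \<le> n \<Longrightarrow> coeff (S p) n = al n * coeff p n"
  using centred_coeff_S_top[of p n] centred_coeff_top[of "S p" n] centred_coeff_top[of p n] degree_S_le[of p n] by simp

text \<open>As no \<open>ga (Suc n)\<close> vanishes, leading terms can be matched from the top
  downwards. The necessity proof uses this to write every \<open>P k\<close> as a divided
  difference.\<close>

lemma D_surj: "\<exists>g. D g = p"
proof -
  have "\<exists>g. D g = p" if "degree p \<le> n" for n
    using that
  proof (induction n arbitrary: p)
    case 0
    then obtain k where "p = [:k:]" by (auto elim: degree_eq_zeroE)
    moreover have "D (smult k \<xi>) = [:k:]" by (simp add: D_smult D_shift)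
    ultimately show ?case by blast
  next
    case (Suc n)
    define f where "f = monom (coeff p (Suc n) / ga (Suc (Suc n))) (Suc (Suc n))"
    have f: "degree f \<le> Suc (Suc n)" by (simp add: f_def degree_monom_le)
    have "degree (p - D f) \<le> n"
      by (rule degree_diff_cancel_less)
        (use Suc.prems f degree_D_le coeff_D_top[OF f] ga_nonzero[of "Suc (Suc n)"] in \<open>auto simp: f_def\<close>)
    then obtain g where "D g = p - D f" using Suc.IH by blast
    then have "D (g + f) = p" by (simp add: D_add)
    then show ?case by blast
  qed
  then show ?thesis by blast
qed

section \<open>The data of the equation and their shift\<close>

definition dcoeff :: "complex poly \<Rightarrow> complex poly \<Rightarrow> nat \<Rightarrow> complex" where
  "dcoeff \<phi> \<psi> n = centred_coeff \<phi> 2 * ga n + centred_coeff \<psi> 1 * al n"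

definition ecoeff :: "complex poly \<Rightarrow> complex poly \<Rightarrow> nat \<Rightarrow> complex" where
  "ecoeff \<phi> \<psi> n = centred_coeff \<phi> 1 * ga n + centred_coeff \<psi> 0 * al n"

text \<open>The polynomial \<phi>^[n] of the theorem in the variable y = x - c; the centred
  coefficients of \<phi> at 1 and 0 are \<phi>'(c) and \<phi>(c), and that of \<psi> at 0 is
  \<psi>(c).\<close>

definition Phi :: "complex poly \<Rightarrow> complex poly \<Rightarrow> nat \<Rightarrow> complex \<Rightarrow> complex" where
  "Phi \<phi> \<psi> n y = (centred_coeff \<psi> 1 * (\<alpha>\<^sup>2 - 1) * ga (2 * n) + centred_coeff \<phi> 2 * al (2 * n)) * (y\<^sup>2 - 2 * \<omega>)
     + (centred_coeff \<phi> 1 * al n + centred_coeff \<psi> 0 * (\<alpha>\<^sup>2 - 1) * ga n) * y + centred_coeff \<phi> 0 + 2 * centred_coeff \<phi> 2 * \<omega>"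

text \<open>Together with \<open>psi_next\<close> this is chosen so that
  \<open>raise_op_phi_next\<close> holds, the cancellation on which the equation of the derived
  functional rests.\<close>

definition phi_next :: "complex poly \<Rightarrow> complex poly \<Rightarrow> complex poly" where
  "phi_next \<phi> \<psi> = S \<phi> + W * S \<psi> + [:\<alpha>:] * V * D \<psi>"

definition psi_next :: "complex poly \<Rightarrow> complex poly \<Rightarrow> complex poly" where
  "psi_next \<phi> \<psi> = D \<phi> + [:\<alpha>:] * S \<psi> + W * D \<psi>"

lemma degree_1_expand:
  assumes "degree p \<le> 1"
  shows "p = [:centred_coeff p 0:] + [:centred_coeff p 1:] * \<xi>"
proof (rule centred_coeff_inject)
  fix i show "centred_coeff p i = centred_coeff ([:centred_coeff p 0:] + [:centred_coeff p 1:] * \<xi>) i"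
    using centred_coeff_eq_0[of p i] assms unfolding centred_coeff_add centred_coeff_const centred_coeff_const_mult centred_coeff_shift by auto
qed

lemma degree_2_expand:
  assumes "degree p \<le> 2"
  shows "p = [:centred_coeff p 0:] + [:centred_coeff p 1:] * \<xi> + [:centred_coeff p 2:] * (\<xi> * \<xi>)"
proof (rule centred_coeff_inject)
  fix i
  have "centred_coeff (\<xi> * \<xi>) i = (if i = 2 then 1 else 0)" by (cases i) (auto simp: centred_coeff_shift)
  then show "centred_coeff p i = centred_coeff ([:centred_coeff p 0:] + [:centred_coeff p 1:] * \<xi> + [:centred_coeff p 2:] * (\<xi> * \<xi>)) i"
    using centred_coeff_eq_0[of p i] assms unfolding centred_coeff_add centred_coeff_const centred_coeff_const_mult centred_coeff_shift
    by (cases "i = 0 \<or> i = 1 \<or> i = 2") auto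
qed

text \<open>The origin of d_n: \<open>raise_op\<close> raises the degree n by exactly one precisely
  when d_n is not 0.\<close>

lemma degree_raise_op:
  assumes "degree \<phi> \<le> 2" "degree \<psi> \<le> 1" "degree f \<le> n"
  shows "degree (raise_op \<phi> \<psi> f) \<le> Suc n" "coeff (raise_op \<phi> \<psi> f) (Suc n) = dcoeff \<phi> \<psi> n * coeff f n"
proof -
  have \<psi>: "degree (\<psi> * S f) \<le> 1 + n" "coeff (\<psi> * S f) (1 + n) = coeff \<psi> 1 * (al n * coeff f n)"
    using assms degree_S_le[of f n] coeff_S_top[of f n] coeff_mult_degree_bounds[of \<psi> 1 "S f" n]
    by (auto intro: order_trans[OF degree_mult_le])
  have "degree (\<phi> * D f) \<le> Suc n \<and> coeff (\<phi> * D f) (Suc n) = coeff \<phi> 2 * (ga n * coeff f n)"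
  proof (cases n)
    case 0
    then obtain k where "f = [:k:]" using assms by (auto elim: degree_eq_zeroE)
    then show ?thesis using 0 by (simp add: D_const)
  next
    case (Suc m)
    then show ?thesis
      using assms degree_D_le[of f m] coeff_D_top[of f m] coeff_mult_degree_bounds[of \<phi> 2 "D f" m]
      by (auto intro!: order_trans[OF degree_mult_le])
  qed
  then show "degree (raise_op \<phi> \<psi> f) \<le> Suc n" "coeff (raise_op \<phi> \<psi> f) (Suc n) = dcoeff \<phi> \<psi> n * coeff f n"
    using \<psi> assms unfolding raise_op_def dcoeff_def
    by (auto intro!: degree_add_le simp: centred_coeff_top algebra_simps)
qed

text \<open>Once the new pair is written in powers of \<open>\<xi>\<close>, the shifts are the
  addition formulas for \<alpha>_n and \<gamma>_n. They make induction over the functional possible: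
  facts at n for the derived equation are facts at n + 1 for the original one.\<close>

lemma
  assumes "degree \<phi> \<le> 2" "degree \<psi> \<le> 1"
  shows degree_phi_next: "degree (phi_next \<phi> \<psi>) \<le> 2"
    and degree_psi_next: "degree (psi_next \<phi> \<psi>) \<le> 1"
    and dcoeff_next: "dcoeff (phi_next \<phi> \<psi>) (psi_next \<phi> \<psi>) n = dcoeff \<phi> \<psi> (n + 2)"
    and ecoeff_next: "ecoeff (phi_next \<phi> \<psi>) (psi_next \<phi> \<psi>) n = ecoeff \<phi> \<psi> (n + 1)"
    and Phi_next: "Phi (phi_next \<phi> \<psi>) (psi_next \<phi> \<psi>) n y = Phi \<phi> \<psi> (n + 1) y"
    and raise_op_phi_next: "raise_op \<phi> \<psi> (phi_next \<phi> \<psi>)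
      = [:\<alpha>:] * companion_op \<phi> \<psi> (psi_next \<phi> \<psi>) + W * raise_op \<phi> \<psi> (psi_next \<phi> \<psi>)"
proof -
  define f0 f1 f2 g0 g1 where f: "f0 = centred_coeff \<phi> 0" "f1 = centred_coeff \<phi> 1" "f2 = centred_coeff \<phi> 2" "g0 = centred_coeff \<psi> 0" "g1 = centred_coeff \<psi> 1"
  have \<phi>: "\<phi> = [:f0:] + [:f1:] * \<xi> + [:f2:] * (\<xi> * \<xi>)" unfolding f by (rule degree_2_expand) fact
  have \<psi>: "\<psi> = [:g0:] + [:g1:] * \<xi>" unfolding f by (rule degree_1_expand) fact
  have D_quadratic: "D ([:k:] + [:l:] * \<xi> + [:m:] * (\<xi> * \<xi>)) = [:l:] + [:m:] * ([:\<alpha>:] + [:\<alpha>:]) * \<xi>"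
    and S_quadratic: "S ([:k:] + [:l:] * \<xi> + [:m:] * (\<xi> * \<xi>))
      = [:k:] + [:l:] * [:\<alpha>:] * \<xi> + [:m:] * (V + [:\<alpha>:] * [:\<alpha>:] * (\<xi> * \<xi>))" for k l m
    unfolding D_add D_const D_const_mult D_shift_mult D_shift S_add S_const S_const_mult S_shift_mult S_shift
    by algebra+
  have D_linear: "D ([:k:] + [:l:] * \<xi>) = [:l:]"
    and S_linear: "S ([:k:] + [:l:] * \<xi>) = [:k:] + [:l:] * [:\<alpha>:] * \<xi>" for k l
    unfolding D_add D_const D_const_mult D_shift S_add S_const S_const_mult S_shift by (simp_all add: mult.assoc)
  have D\<phi>: "D \<phi> = [:f1:] + [:f2:] * ([:\<alpha>:] + [:\<alpha>:]) * \<xi>"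
    and S\<phi>: "S \<phi> = [:f0:] + [:f1:] * [:\<alpha>:] * \<xi> + [:f2:] * (V + [:\<alpha>:] * [:\<alpha>:] * (\<xi> * \<xi>))"
    and D\<psi>: "D \<psi> = [:g1:]" and S\<psi>: "S \<psi> = [:g0:] + [:g1:] * [:\<alpha>:] * \<xi>"
    unfolding \<phi> \<psi> by (fact D_quadratic S_quadratic D_linear S_linear)+
  have V: "V = ([:\<alpha>:] * [:\<alpha>:] - 1) * (\<xi> * \<xi> - [:4 * \<omega>:])"
    unfolding V_def power2_eq_square[of \<xi>] alpha_poly ..
  define b where "b = \<alpha>\<^sup>2 - 1"
  have bb: "[:b:] = [:\<alpha>:] * [:\<alpha>:] - 1" unfolding b_def by (rule alpha_poly)
  have k: "[:f0 - 4 * \<omega> * b * (f2 + \<alpha> * g1):] = [:f0:] - [:4 * \<omega>:] * [:b:] * ([:f2:] + [:\<alpha>:] * [:g1:])"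
    "[:f1 * \<alpha> + g0 * b:] = [:f1:] * [:\<alpha>:] + [:g0:] * [:b:]"
    "[:f2 * (2 * \<alpha>\<^sup>2 - 1) + 2 * \<alpha> * b * g1:]
      = [:f2:] * ([:\<alpha>:] * [:\<alpha>:] + [:\<alpha>:] * [:\<alpha>:] - 1) + ([:\<alpha>:] + [:\<alpha>:]) * [:b:] * [:g1:]"
    "[:f1 + \<alpha> * g0:] = [:f1:] + [:\<alpha>:] * [:g0:]"
    "[:2 * \<alpha> * f2 + (2 * \<alpha>\<^sup>2 - 1) * g1:]
      = ([:\<alpha>:] + [:\<alpha>:]) * [:f2:] + ([:\<alpha>:] * [:\<alpha>:] + [:\<alpha>:] * [:\<alpha>:] - 1) * [:g1:]"
    by (simp_all add: one_pCons power2_eq_square algebra_simps)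
  \<comment> \<open>The constant term of \<open>V\<close> enters twice, through
    \<open>S \<phi>\<close> and through \<open>[:\<alpha>:] * V * D \<psi>\<close>.\<close>
  have phn: "phi_next \<phi> \<psi> = [:f0 - 4 * \<omega> * b * (f2 + \<alpha> * g1):] + [:f1 * \<alpha> + g0 * b:] * \<xi>
      + [:f2 * (2 * \<alpha>\<^sup>2 - 1) + 2 * \<alpha> * b * g1:] * (\<xi> * \<xi>)"
    unfolding phi_next_def S\<phi> S\<psi> D\<psi> W_def V alpha_poly k bb by algebra
  have psn: "psi_next \<phi> \<psi> = [:f1 + \<alpha> * g0:] + [:2 * \<alpha> * f2 + (2 * \<alpha>\<^sup>2 - 1) * g1:] * \<xi>"
    unfolding psi_next_def D\<phi> S\<psi> D\<psi> W_def alpha_poly k by algebra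
  have cfxx: "centred_coeff (\<xi> * \<xi>) i = (if i = 2 then 1 else 0)" for i
    by (cases i) (auto simp: centred_coeff_shift)
  have cfphi: "centred_coeff (phi_next \<phi> \<psi>) i = (if i = 0 then f0 - 4 * \<omega> * b * (f2 + \<alpha> * g1)
      else if i = 1 then f1 * \<alpha> + g0 * b else if i = 2 then f2 * (2 * \<alpha>\<^sup>2 - 1) + 2 * \<alpha> * b * g1 else 0)" for i
    unfolding phn centred_coeff_add centred_coeff_const centred_coeff_const_mult centred_coeff_shift cfxx by simp
  have cfpsi: "centred_coeff (psi_next \<phi> \<psi>) i = (if i = 0 then f1 + \<alpha> * g0
      else if i = 1 then 2 * \<alpha> * f2 + (2 * \<alpha>\<^sup>2 - 1) * g1 else 0)" for i
    unfolding psn centred_coeff_add centred_coeff_const centred_coeff_const_mult centred_coeff_shift by simp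
  show "degree (phi_next \<phi> \<psi>) \<le> 2" "degree (psi_next \<phi> \<psi>) \<le> 1"
    by (rule centred_coeff_degree_le; simp add: cfphi cfpsi)+
  have al2: "al (Suc (Suc n)) = (2 * \<alpha>\<^sup>2 - 1) * al n + 2 * \<alpha> * b * ga n"
    and ga2: "ga (Suc (Suc n)) = (2 * \<alpha>\<^sup>2 - 1) * ga n + 2 * \<alpha> * al n" for n
    unfolding al_Suc ga_Suc b_def by algebra+
  have cfs: "centred_coeff (phi_next \<phi> \<psi>) 0 = f0 - 4 * \<omega> * b * (f2 + \<alpha> * g1)"
    "centred_coeff (phi_next \<phi> \<psi>) 1 = f1 * \<alpha> + g0 * b" "centred_coeff (psi_next \<phi> \<psi>) 0 = f1 + \<alpha> * g0"
    "centred_coeff (phi_next \<phi> \<psi>) 2 = f2 * (2 * \<alpha>\<^sup>2 - 1) + 2 * \<alpha> * b * g1"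
    "centred_coeff (psi_next \<phi> \<psi>) 1 = 2 * \<alpha> * f2 + (2 * \<alpha>\<^sup>2 - 1) * g1"
    unfolding cfphi cfpsi by simp_all
  have n: "n + 2 = Suc (Suc n)" "n + 1 = Suc n" "2 * Suc n = Suc (Suc (2 * n))" by simp_all
  show "dcoeff (phi_next \<phi> \<psi>) (psi_next \<phi> \<psi>) n = dcoeff \<phi> \<psi> (n + 2)"
    unfolding dcoeff_def cfs f[symmetric] n al2 ga2 by (simp add: b_def algebra_simps power2_eq_square)
  show "ecoeff (phi_next \<phi> \<psi>) (psi_next \<phi> \<psi>) n = ecoeff \<phi> \<psi> (n + 1)"
    unfolding ecoeff_def cfs f[symmetric] n al_Suc ga_Suc by (simp add: b_def algebra_simps power2_eq_square)
  show "Phi (phi_next \<phi> \<psi>) (psi_next \<phi> \<psi>) n y = Phi \<phi> \<psi> (n + 1) y"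
    unfolding Phi_def cfs f[symmetric] n al2 ga2 al_Suc[of n] ga_Suc[of n] b_def
    by (simp add: algebra_simps power2_eq_square)
  show "raise_op \<phi> \<psi> (phi_next \<phi> \<psi>) = [:\<alpha>:] * companion_op \<phi> \<psi> (psi_next \<phi> \<psi>) + W * raise_op \<phi> \<psi> (psi_next \<phi> \<psi>)"
    unfolding raise_op_def companion_op_def phn psn D_quadratic S_quadratic D_linear S_linear
    unfolding k unfolding \<phi> \<psi> W_def V bb alpha_poly by algebra
qed

subsection \<open>Functionals satisfying a Pearson equation\<close>

text \<open>The lattice equation with both transposes moved onto the test polynomial.\<close>

definition pearson :: "(complex poly \<Rightarrow> complex) \<Rightarrow> complex poly \<Rightarrow> complex poly \<Rightarrow> bool" where
  "pearson u \<phi> \<psi> \<longleftrightarrow> u \<in> poly_dual \<and> degree \<phi> \<le> 2 \<and> degree \<psi> \<le> 1 \<and> (\<forall>p. u (raise_op \<phi> \<psi> p) = 0)"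

text \<open>The functional u' of the opening text; the sign makes the factor in
  \<open>derived_mult_D\<close> equal to \<alpha> and not its negative.\<close>

definition derived :: "(complex poly \<Rightarrow> complex) \<Rightarrow> complex poly \<Rightarrow> complex poly \<Rightarrow> complex poly \<Rightarrow> complex" where
  "derived u \<phi> \<psi> p = - u (companion_op \<phi> \<psi> p)"

lemma derived_poly_dual:
  assumes "u \<in> poly_dual"
  shows "derived u \<phi> \<psi> \<in> poly_dual"
proof -
  have add: "companion_op \<phi> \<psi> (p + q) = companion_op \<phi> \<psi> p + companion_op \<phi> \<psi> q" for p q
    unfolding companion_op_def S_add D_add by algebra
  have smult: "companion_op \<phi> \<psi> (smult k p) = smult k (companion_op \<phi> \<psi> p)" for k p
    unfolding companion_op_def S_smult D_smult by (simp add: smult_add_right)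
  show ?thesis
    using assms unfolding poly_dual_def
    by (simp add: Vector_Spaces.linear_iff derived_def add smult)
qed

lemma derived_mult_D:
  assumes "pearson u \<phi> \<psi>"
  shows "derived u \<phi> \<psi> (f * D p) = \<alpha> * u (raise_op \<phi> \<psi> f * p)"
proof -
  have u: "u \<in> poly_dual" "\<And>p. u (raise_op \<phi> \<psi> p) = 0" using assms unfolding pearson_def by auto
  have "u (companion_op \<phi> \<psi> (f * D p) + [:\<alpha>:] * raise_op \<phi> \<psi> f * p) = 0" unfolding companion_op_mult_D by (rule u(2))
  then show ?thesis
    unfolding derived_def mult.assoc poly_dual_add[OF u(1)] poly_dual_const_mult[OF u(1)]
    by (simp add: add_eq_0_iff)
qed

lemma derived_mult_S:
  assumes "pearson u \<phi> \<psi>"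
  shows "derived u \<phi> \<psi> (f * S p) = - \<alpha> * u (([:\<alpha>:] * companion_op \<phi> \<psi> f + W * raise_op \<phi> \<psi> f) * p)"
proof -
  have u: "u \<in> poly_dual" "\<And>p. u (raise_op \<phi> \<psi> p) = 0" using assms unfolding pearson_def by auto
  have "u (companion_op \<phi> \<psi> (f * S p) - [:\<alpha>:] * ([:\<alpha>:] * companion_op \<phi> \<psi> f + W * raise_op \<phi> \<psi> f) * p) = 0"
    unfolding companion_op_mult_S by (rule u(2))
  then show ?thesis
    unfolding derived_def mult.assoc[of "[:\<alpha>:]" _ p] poly_dual_diff[OF u(1)] poly_dual_const_mult[OF u(1)]
    by simp
qed

text \<open>The contribution of \<open>phi_next\<close>, computed by \<open>derived_mult_D\<close>,
  and that of \<open>psi_next\<close>, computed by \<open>derived_mult_S\<close>, cancel by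
  \<open>raise_op_phi_next\<close>.\<close>

lemma pearson_derived:
  assumes "pearson u \<phi> \<psi>"
  shows "pearson (derived u \<phi> \<psi>) (phi_next \<phi> \<psi>) (psi_next \<phi> \<psi>)"
proof -
  have deg: "degree \<phi> \<le> 2" "degree \<psi> \<le> 1" and u: "u \<in> poly_dual"
    using assms unfolding pearson_def by auto
  have "derived u \<phi> \<psi> (raise_op (phi_next \<phi> \<psi>) (psi_next \<phi> \<psi>) p) = 0" for p
    unfolding raise_op_def[of "phi_next \<phi> \<psi>"] poly_dual_add[OF derived_poly_dual[OF u]]
      derived_mult_D[OF assms] derived_mult_S[OF assms] raise_op_phi_next[OF deg] by simp
  then show ?thesis
    using degree_phi_next[OF deg] degree_psi_next[OF deg] derived_poly_dual[OF u]
    unfolding pearson_def by blast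
qed

text \<open>The evaluation point of \<phi>^[n], measured from c.\<close>

definition node :: "complex poly \<Rightarrow> complex poly \<Rightarrow> nat \<Rightarrow> complex" where
  "node \<phi> \<psi> n = - ecoeff \<phi> \<psi> n / dcoeff \<phi> \<psi> (2 * n)"

text \<open>The prospective C_(n+1). At n = 0 the general formula formally contains d_(-1) / d_(-1),
  whence the separate branch.\<close>

definition norm_quotient :: "complex poly \<Rightarrow> complex poly \<Rightarrow> nat \<Rightarrow> complex" where
  "norm_quotient \<phi> \<psi> n = (if n = 0 then - (1 / dcoeff \<phi> \<psi> 1)
     else - (ga (n + 1) * dcoeff \<phi> \<psi> (n - 1) / (dcoeff \<phi> \<psi> (2 * n - 1) * dcoeff \<phi> \<psi> (2 * n + 1))))
     * Phi \<phi> \<psi> n (node \<phi> \<psi> n)"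

text \<open>The equation is tested on 1 and on \<open>\<xi>\<close>. The second identity matters
  because u' takes the value \<open>- u \<phi>\<close> at 1, so it decides whether u' can carry an
  orthogonal family.\<close>

lemma pearson_moments:
  assumes p: "pearson u \<phi> \<psi>" and d0: "dcoeff \<phi> \<psi> 0 \<noteq> 0"
  shows "u \<xi> = node \<phi> \<psi> 0 * u 1"
    and "dcoeff \<phi> \<psi> 1 * u \<phi> = \<alpha> * dcoeff \<phi> \<psi> 0 * Phi \<phi> \<psi> 0 (node \<phi> \<psi> 0) * u 1"
proof -
  define f0 f1 f2 g0 g1 where f: "f0 = centred_coeff \<phi> 0" "f1 = centred_coeff \<phi> 1" "f2 = centred_coeff \<phi> 2" "g0 = centred_coeff \<psi> 0" "g1 = centred_coeff \<psi> 1"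
  define y where "y = node \<phi> \<psi> 0"
  have u: "u \<in> poly_dual" "\<And>p. u (raise_op \<phi> \<psi> p) = 0" and deg: "degree \<phi> \<le> 2" "degree \<psi> \<le> 1"
    using p unfolding pearson_def by auto
  have \<phi>: "\<phi> = [:f0:] * 1 + [:f1:] * \<xi> + [:f2:] * (\<xi> * \<xi>)"
    using degree_2_expand[OF deg(1)] unfolding f by simp
  have \<psi>: "\<psi> = [:g0:] * 1 + [:g1:] * \<xi>" using degree_1_expand[OF deg(2)] unfolding f by simp
  note lin = poly_dual_add[OF u(1)] poly_dual_const_mult[OF u(1)]
  have g1: "g1 \<noteq> 0" and d: "dcoeff \<phi> \<psi> 0 = g1" "dcoeff \<phi> \<psi> 1 = f2 + g1 * \<alpha>" and y: "g1 * y = - g0"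
    using d0 by (simp_all add: dcoeff_def f y_def node_def ecoeff_def)
  have P: "Phi \<phi> \<psi> 0 y = f2 * y\<^sup>2 + f1 * y + f0" unfolding Phi_def f by (simp add: algebra_simps)
  have u\<phi>: "u \<phi> = f0 * u 1 + f1 * u \<xi> + f2 * u (\<xi> * \<xi>)" unfolding \<phi> lin ..
  have "raise_op \<phi> \<psi> 1 = \<psi>" unfolding raise_op_def D_1 S_1 by simp
  then have "u \<psi> = 0" using u(2) by metis
  then have "g0 * u 1 + g1 * u \<xi> = 0" unfolding \<psi> lin .
  then have "g1 * u \<xi> = g1 * (y * u 1)" using y by algebra
  then have u\<xi>: "u \<xi> = y * u 1" using g1 by simp
  then show "u \<xi> = node \<phi> \<psi> 0 * u 1" unfolding y_def .
  have raise_op\<xi>: "raise_op \<phi> \<psi> \<xi> = \<phi> + [:\<alpha>:] * ([:g0:] * \<xi> + [:g1:] * (\<xi> * \<xi>))"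
    unfolding raise_op_def D_shift S_shift \<psi> by algebra
  have 2: "u \<phi> + \<alpha> * (g0 * u \<xi> + g1 * u (\<xi> * \<xi>)) = 0" using u(2)[of \<xi>] unfolding raise_op\<xi> lin .
  \<comment> \<open>The second moment \<open>u (\<xi> * \<xi>)\<close> is eliminated between
    \<open>2\<close> and \<open>u\<phi>\<close>.\<close>
  have "(f2 + g1 * \<alpha>) * u \<phi> = \<alpha> * g1 * (f2 * y\<^sup>2 + f1 * y + f0) * u 1"
    using 2 u\<phi> unfolding u\<xi> using y by algebra
  then show "dcoeff \<phi> \<psi> 1 * u \<phi> = \<alpha> * dcoeff \<phi> \<psi> 0 * Phi \<phi> \<psi> 0 (node \<phi> \<psi> 0) * u 1"
    unfolding d y_def[symmetric] P .
qed

section \<open>Derived families: norms, second coefficients, existence\<close>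

definition derived_family :: "(nat \<Rightarrow> complex poly) \<Rightarrow> nat \<Rightarrow> complex poly" where
  "derived_family P n = smult (1 / ga (Suc n)) (D (P (Suc n)))"

text \<open>By adjointness, pairing members n and m under u' amounts to pairing
  \<open>P (Suc n)\<close> with \<open>raise_op\<close> of member m, of degree at most m + 1 and
  with coefficient d_m there. This is 0 for m < n, and for m = n it leaves d_n times the old
  norm.\<close>

lemma derived_family_orthogonal:
  assumes p: "pearson u \<phi> \<psi>" and P: "monic_orthogonal_family u {0..Suc L} P"
    and d: "\<And>j. j \<le> L \<Longrightarrow> dcoeff \<phi> \<psi> j \<noteq> 0"
  shows "monic_orthogonal_family (derived u \<phi> \<psi>) {0..L} (derived_family P)"
    and "n \<le> L \<Longrightarrow> derived u \<phi> \<psi> (derived_family P n * derived_family P n)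
      = \<alpha> * dcoeff \<phi> \<psi> n / ga (Suc n) * u (P (Suc n) * P (Suc n))"
proof -
  let ?Q = "derived_family P"
  have u: "u \<in> poly_dual" and deg: "degree \<phi> \<le> 2" "degree \<psi> \<le> 1"
    using p unfolding pearson_def by auto
  have PS: "degree (P (Suc n)) \<le> Suc n" "coeff (P (Suc n)) (Suc n) = 1" if "n \<le> L" for n
    using monic_orthogonal_familyD(1,2)[OF P, of "Suc n"] that by auto
  have Q: "degree (?Q n) \<le> n" "coeff (?Q n) n = 1" if "n \<le> L" for n
    using PS[OF that] degree_D_le coeff_D_top ga_nonzero[of "Suc n"]
    by (auto simp: derived_family_def intro: order_trans[OF degree_smult_le])
  have QQ: "derived u \<phi> \<psi> (?Q n * ?Q m) = \<alpha> / ga (Suc n) * u (P (Suc n) * raise_op \<phi> \<psi> (?Q m))" for m n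
  proof -
    have eq: "?Q n * ?Q m = smult (1 / ga (Suc n)) (?Q m * D (P (Suc n)))"
      by (simp add: derived_family_def[of P n] mult.commute)
    show ?thesis
      unfolding eq poly_dual_smult[OF derived_poly_dual[OF u]] derived_mult_D[OF p] by (simp add: mult.commute)
  qed
  show norm: "derived u \<phi> \<psi> (?Q n * ?Q n) = \<alpha> * dcoeff \<phi> \<psi> n / ga (Suc n) * u (P (Suc n) * P (Suc n))"
    if "n \<le> L" for n
    unfolding QQ using orthogonal_same_degree[OF u P, of "Suc n" "raise_op \<phi> \<psi> (?Q n)"]
      degree_raise_op[OF deg Q(1)] Q(2) that by simp
  show "monic_orthogonal_family (derived u \<phi> \<psi>) {0..L} ?Q"
  proof (rule monic_orthogonal_familyI)
    fix n assume n: "n \<in> {0..L}"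
    then have n': "n \<le> L" by simp
    show "coeff (?Q n) n = 1" using Q(2) n by simp
    then show "degree (?Q n) = n" using Q(1) n by (metis atLeastAtMost_iff le_antisym le_degree one_neq_zero)
    show "derived u \<phi> \<psi> (?Q n * ?Q n) \<noteq> 0"
      unfolding norm[OF n'] using d alpha_nonzero ga_nonzero[of "Suc n"] n'
        monic_orthogonal_familyD(3)[OF P, of "Suc n"] by simp
    fix m assume "m \<in> {0..L}" "m < n"
    then have "u (P (Suc n) * raise_op \<phi> \<psi> (?Q m)) = 0"
      using orthogonal_lower_degree[OF u P _ degree_raise_op(1)[OF deg Q(1)], of "Suc n" m] n' by simp
    then show "derived u \<phi> \<psi> (?Q n * ?Q m) = 0" unfolding QQ by simp
  qed
qed

lemma derived_one: "derived u \<phi> \<psi> 1 = - u \<phi>"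
  by (simp add: derived_def companion_op_def S_1 D_1)

lemma monic_orthogonal_family_0:
  "monic_orthogonal_family u {0..n} P \<Longrightarrow> P 0 = 1"
  using monic_orthogonal_familyD(1,2)[of u "{0..n}" P 0] by (auto elim: degree_eq_zeroE)

text \<open>The last factor undoes the renormalisation: it is the quotient of the factors \<alpha>
  d_n / \<gamma>_(n+1) and \<alpha> d_(n+1) / \<gamma>_(n+2) relating new norms to old ones.\<close>

lemma norm_quotient_next:
  assumes "degree \<phi> \<le> 2" "degree \<psi> \<le> 1" "dcoeff \<phi> \<psi> n \<noteq> 0" "dcoeff \<phi> \<psi> (Suc n) \<noteq> 0"
  shows "norm_quotient \<phi> \<psi> (Suc n) = norm_quotient (phi_next \<phi> \<psi>) (psi_next \<phi> \<psi>) n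
    * (dcoeff \<phi> \<psi> n * ga (n + 2) / (ga (Suc n) * dcoeff \<phi> \<psi> (Suc n)))"
proof -
  have y: "node (phi_next \<phi> \<psi>) (psi_next \<phi> \<psi>) n = node \<phi> \<psi> (Suc n)"
    unfolding node_def ecoeff_next[OF assms(1,2)] dcoeff_next[OF assms(1,2)] by simp
  note simps = y Phi_next[OF assms(1,2)] dcoeff_next[OF assms(1,2)]
  show ?thesis
  proof (cases n)
    case 0
    then show ?thesis using assms(3,4) unfolding norm_quotient_def simps by (simp add: numeral_3_eq_3 numeral_2_eq_2 mult_ac)
  next
    case (Suc m)
    have "2 * n - 1 + 2 = 2 * Suc n - 1" "2 * n + 1 + 2 = 2 * Suc n + 1" "n - 1 + 2 = Suc n"
      "Suc n - 1 = n" "Suc n + 1 = n + 2" "n + 1 = Suc n" "n \<noteq> 0"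
      using Suc by simp_all
    then show ?thesis
      using assms(3,4) ga_nonzero[of "Suc n"] unfolding norm_quotient_def simps by simp
  qed
qed

text \<open>Induction with u, \<phi>, \<psi> varying: the ratio at n + 1 is the ratio at n of the
  derived family, renormalised. The bound 2 n + 1 on the indices of d fits the shift by 2.\<close>

lemma norm_ratio:
  assumes "pearson u \<phi> \<psi>" "monic_orthogonal_family u {0..Suc n} P"
    "\<And>j. j \<le> 2 * n + 1 \<Longrightarrow> dcoeff \<phi> \<psi> j \<noteq> 0"
  shows "u (P (Suc n) * P (Suc n)) = norm_quotient \<phi> \<psi> n * u (P n * P n)"
  using assms
proof (induction n arbitrary: u \<phi> \<psi> P)
  case 0
  have d: "dcoeff \<phi> \<psi> 0 \<noteq> 0" "dcoeff \<phi> \<psi> 1 \<noteq> 0" using 0 by auto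
  note Q = derived_family_orthogonal[OF 0(1,2)]
  \<comment> \<open>The norm of this first derived member is u'(1), which
    \<open>pearson_moments\<close> evaluates.\<close>
  have "derived_family P 0 = 1" by (rule monic_orthogonal_family_0[OF Q(1)]) (use d in simp)
  then have "- u \<phi> = \<alpha> * dcoeff \<phi> \<psi> 0 * u (P 1 * P 1)"
    using Q(2)[of 0] d derived_one[of u \<phi> \<psi>] by simp
  then have "\<alpha> * dcoeff \<phi> \<psi> 0 * (dcoeff \<phi> \<psi> 1 * u (P 1 * P 1)) = \<alpha> * dcoeff \<phi> \<psi> 0 * - (Phi \<phi> \<psi> 0 (node \<phi> \<psi> 0) * u 1)"
    using pearson_moments(2)[OF 0(1) d(1)] by algebra
  then have "dcoeff \<phi> \<psi> 1 * u (P 1 * P 1) = - (Phi \<phi> \<psi> 0 (node \<phi> \<psi> 0) * u 1)"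
    by (rule mult_left_cancel[THEN iffD1, rotated]) (use d alpha_nonzero in simp)
  then show ?case
    using monic_orthogonal_family_0[OF 0(2)] d by (simp add: norm_quotient_def field_simps)
next
  case (Suc n)
  have deg: "degree \<phi> \<le> 2" "degree \<psi> \<le> 1" using Suc.prems(1) unfolding pearson_def by auto
  note Q = derived_family_orthogonal[OF Suc.prems(1,2)]
  have Q1: "monic_orthogonal_family (derived u \<phi> \<psi>) {0..Suc n} (derived_family P)"
    by (rule Q(1)) (use Suc.prems(3) in simp)
  define k where "k = norm_quotient (phi_next \<phi> \<psi>) (psi_next \<phi> \<psi>) n"
  define H G where "H = u (P (Suc (Suc n)) * P (Suc (Suc n)))" and "G = u (P (Suc n) * P (Suc n))"
  have "derived u \<phi> \<psi> (derived_family P (Suc n) * derived_family P (Suc n))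
    = k * derived u \<phi> \<psi> (derived_family P n * derived_family P n)"
    unfolding k_def
    by (rule Suc.IH[OF pearson_derived[OF Suc.prems(1)] Q1]) (use Suc.prems(3) dcoeff_next[OF deg] in auto)
  then have eq: "\<alpha> * dcoeff \<phi> \<psi> (Suc n) / ga (Suc (Suc n)) * H = k * (\<alpha> * dcoeff \<phi> \<psi> n / ga (Suc n) * G)"
    using Q(2)[of n] Q(2)[of "Suc n"] Suc.prems(3) unfolding H_def G_def by simp
  have nz: "dcoeff \<phi> \<psi> n \<noteq> 0" "dcoeff \<phi> \<psi> (Suc n) \<noteq> 0" "ga (Suc n) \<noteq> 0" "ga (Suc (Suc n)) \<noteq> 0"
    using Suc.prems(3) ga_nonzero by auto
  have "H = k * (dcoeff \<phi> \<psi> n * ga (Suc (Suc n)) / (ga (Suc n) * dcoeff \<phi> \<psi> (Suc n))) * G"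
    using eq nz alpha_nonzero by (simp add: field_simps)
  then show ?case
    using norm_quotient_next[OF deg nz(1,2)] unfolding H_def G_def k_def by simp
qed

text \<open>The base case is orthogonality of \<open>P 1\<close> to 1. In the step \<open>D\<close>
  carries second coefficients to second coefficients, so the value for the derived family lifts
  after division by \<gamma>_(n+1).\<close>

lemma second_coefficient:
  assumes "pearson u \<phi> \<psi>" "monic_orthogonal_family u {0..Suc n} P"
    "\<And>j. j \<le> 2 * n \<Longrightarrow> dcoeff \<phi> \<psi> j \<noteq> 0"
  shows "centred_coeff (P (Suc n)) n = - ga (Suc n) * node \<phi> \<psi> n"
  using assms
proof (induction n arbitrary: u \<phi> \<psi> P)
  case 0
  have u: "u \<in> poly_dual" using 0(1) unfolding pearson_def by auto
  have P0: "P 0 = 1" by (rule monic_orthogonal_family_0[OF 0(2)])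
  have "degree (P 1) = 1" "coeff (P 1) 1 = 1"
    using monic_orthogonal_familyD(1,2)[OF 0(2), of 1] by auto
  then have P1: "P 1 = [:centred_coeff (P 1) 0:] * 1 + [:1:] * \<xi>"
    using degree_1_expand[of "P 1"] centred_coeff_top[of "P 1" 1] by simp
  have "u (P 1) = 0" using monic_orthogonal_familyD(4)[OF 0(2), of 1 0] P0 by simp
  then have "centred_coeff (P 1) 0 * u 1 + 1 * u \<xi> = 0"
    using P1 poly_dual_add[OF u] poly_dual_const_mult[OF u] by metis
  then have "(centred_coeff (P 1) 0 + node \<phi> \<psi> 0) * u 1 = 0"
    using pearson_moments(1)[OF 0(1)] 0(3)[of 0] by (simp add: algebra_simps)
  moreover have "u 1 \<noteq> 0" using monic_orthogonal_familyD(3)[OF 0(2), of 0] P0 by simp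
  ultimately show ?case by (simp add: add_eq_0_iff)
next
  case (Suc n)
  have deg: "degree \<phi> \<le> 2" "degree \<psi> \<le> 1" using Suc.prems(1) unfolding pearson_def by auto
  have Q: "monic_orthogonal_family (derived u \<phi> \<psi>) {0..Suc n} (derived_family P)"
    by (rule derived_family_orthogonal(1)[OF Suc.prems(1,2)]) (use Suc.prems(3) in simp)
  have "centred_coeff (derived_family P (Suc n)) n = - ga (Suc n) * node (phi_next \<phi> \<psi>) (psi_next \<phi> \<psi>) n"
    by (rule Suc.IH[OF pearson_derived[OF Suc.prems(1)] Q]) (use Suc.prems(3) dcoeff_next[OF deg] in auto)
  moreover have "node (phi_next \<phi> \<psi>) (psi_next \<phi> \<psi>) n = node \<phi> \<psi> (Suc n)"
    unfolding node_def ecoeff_next[OF deg] dcoeff_next[OF deg] by simp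
  moreover have "degree (P (Suc (Suc n))) \<le> Suc (Suc n)"
    using monic_orthogonal_familyD(1)[OF Suc.prems(2), of "Suc (Suc n)"] by simp
  ultimately have "ga (Suc n) * centred_coeff (P (Suc (Suc n))) (Suc n)
      = ga (Suc n) * (- ga (Suc (Suc n)) * node \<phi> \<psi> (Suc n))"
    using ga_nonzero[of "Suc (Suc n)"] centred_coeff_D_second[of "P (Suc (Suc n))" n]
    by (simp add: derived_family_def centred_coeff_smult field_simps)
  then show ?case by (rule mult_left_cancel[OF ga_nonzero, THEN iffD1, rotated]) simp
qed

text \<open>A family one shorter exists for u' by induction, and \<open>raise_op\<close> lifts it to
  u. A shift of d by 2 and of \<phi>^[n] by 1 matches the bounds \<open>2 * L\<close> and
  \<open>L\<close>.\<close>

lemma orthogonal_family_exists: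
  assumes "pearson u \<phi> \<psi>" "u 1 \<noteq> 0" "\<And>j. j < 2 * L \<Longrightarrow> dcoeff \<phi> \<psi> j \<noteq> 0"
    "\<And>n. n < L \<Longrightarrow> Phi \<phi> \<psi> n (node \<phi> \<psi> n) \<noteq> 0"
  shows "\<exists>P. monic_orthogonal_family u {0..L} P"
  using assms
proof (induction L arbitrary: u \<phi> \<psi>)
  case 0
  have "monic_orthogonal_family u {0..0} (\<lambda>_. 1)" by (rule monic_orthogonal_familyI) (use 0 in auto)
  then show ?case by blast
next
  case (Suc L)
  have u: "u \<in> poly_dual" and deg: "degree \<phi> \<le> 2" "degree \<psi> \<le> 1"
    using Suc.prems(1) unfolding pearson_def by auto
  let ?\<phi> = "phi_next \<phi> \<psi>" and ?\<psi> = "psi_next \<phi> \<psi>" and ?u = "derived u \<phi> \<psi>"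
  have d: "dcoeff \<phi> \<psi> j \<noteq> 0" if "j \<le> L" for j using Suc.prems(3)[of j] that by simp
  have d1: "dcoeff \<phi> \<psi> 1 \<noteq> 0" using Suc.prems(3)[of 1] by simp
  have "?u 1 \<noteq> 0"
    using pearson_moments(2)[OF Suc.prems(1)] d[of 0] d1 Suc.prems(2) Suc.prems(4)[of 0] alpha_nonzero
    by (auto simp: derived_one)
  moreover have "node ?\<phi> ?\<psi> n = node \<phi> \<psi> (Suc n)" for n
    unfolding node_def ecoeff_next[OF deg] dcoeff_next[OF deg] by simp
  ultimately obtain Q where Q: "monic_orthogonal_family ?u {0..L} Q"
    using Suc.IH[OF pearson_derived[OF Suc.prems(1)]] Suc.prems(3,4) dcoeff_next[OF deg] Phi_next[OF deg] by auto
  \<comment> \<open>Dividing by d_m makes the raised polynomial monic.\<close>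
  define P where "P n = (case n of 0 \<Rightarrow> 1 | Suc m \<Rightarrow> smult (1 / dcoeff \<phi> \<psi> m) (raise_op \<phi> \<psi> (Q m)))" for n
  have P0: "P 0 = 1" by (simp add: P_def)
  have PS: "degree (P (Suc m)) \<le> Suc m" "coeff (P (Suc m)) (Suc m) = 1" if "m \<le> L" for m
    using degree_raise_op[OF deg, of "Q m" m] monic_orthogonal_familyD(1,2)[OF Q, of m] d[OF that] that
    by (auto simp: P_def intro: order_trans[OF degree_smult_le])
  have lead: "coeff (P n) n = 1" if "n \<le> Suc L" for n
    using P0 PS(2) that by (cases n) auto
  have degP: "degree (P n) = n" if "n \<le> Suc L" for n
    using P0 PS(1) lead[OF that] that by (cases n) (auto intro!: le_antisym le_degree)
  \<comment> \<open>Adjointness read backwards: pairings of the lifted family under u become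
    pairings of \<open>Q\<close> under u'.\<close>
  have PD: "u (P (Suc m) * f) = 1 / (\<alpha> * dcoeff \<phi> \<psi> m) * ?u (Q m * D f)" if "m \<le> L" for m f
    unfolding derived_mult_D[OF Suc.prems(1)] using d[OF that] alpha_nonzero
    by (simp add: P_def poly_dual_smult[OF u])
  have "monic_orthogonal_family u {0..Suc L} P"
  proof (rule monic_orthogonal_familyI)
    fix n assume n: "n \<in> {0..Suc L}"
    show "degree (P n) = n" "coeff (P n) n = 1" using degP lead n by auto
    show "u (P n * P n) \<noteq> 0"
    proof (cases n)
      case 0
      then show ?thesis using P0 Suc.prems(2) by simp
    next
      case (Suc m)
      then have m: "m \<le> L" using n by simp
      have "?u (Q m * D (P (Suc m))) = ga (Suc m) * ?u (Q m * Q m)"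
        using orthogonal_same_degree[OF derived_poly_dual[OF u] Q m, of "D (P (Suc m))"]
          degree_D_le[OF PS(1)[OF m]] coeff_D_top[OF PS(1)[OF m]] PS(2)[OF m] by simp
      then show ?thesis
        using PD[OF m, of "P (Suc m)"] d[OF m] alpha_nonzero ga_nonzero[of "Suc m"]
          monic_orthogonal_familyD(3)[OF Q, of m] m Suc by simp
    qed
    fix m assume m: "m \<in> {0..Suc L}" "m < n"
    then obtain k where k: "n = Suc k" "k \<le> L" "m \<le> k" using n by (cases n) auto
    \<comment> \<open>Differencing lowers the degree below k; for m = 0 the difference is 0.\<close>
    have "?u (Q k * D (P m)) = 0"
    proof (cases m)
      case 0
      then show ?thesis using P0 D_1 poly_dual_0[OF derived_poly_dual[OF u]] by simp
    next
      case (Suc i)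
      then have "degree (D (P m)) \<le> i" using degree_D_le[of "P m" i] degP[of m] m by simp
      then show ?thesis
        using orthogonal_lower_degree[OF derived_poly_dual[OF u] Q k(2)] Suc k by simp
    qed
    then show "u (P n * P m) = 0" using PD[OF k(2), of "P m"] k(1) by simp
  qed
  then show ?case by blast
qed

text \<open>Nondegeneracy is applied to \<open>companion_op \<phi> \<psi> G\<close>, whose degree
  may reach n + 2, so the argument looks beyond \<open>P (Suc n)\<close>.\<close>

lemma regular_imp_dcoeff_nonzero:
  assumes p: "pearson u \<phi> \<psi>" and P: "monic_orthogonal_family u UNIV P" and nz: "\<not> (\<phi> = 0 \<and> \<psi> = 0)"
  shows "dcoeff \<phi> \<psi> n \<noteq> 0"
proof
  assume dn: "dcoeff \<phi> \<psi> n = 0"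
  have u: "u \<in> poly_dual" "\<And>p. u (raise_op \<phi> \<psi> p) = 0" and deg: "degree \<phi> \<le> 2" "degree \<psi> \<le> 1"
    using p unfolding pearson_def by auto
  have PN: "monic_orthogonal_family u {0..L} P" for L
    by (rule monic_orthogonal_family_subset[OF P]) simp
  have regular: "g = 0" if "\<And>k. u (P k * g) = 0" for g
    by (rule orthogonal_nondegenerate[OF u(1) PN[of "degree g"]]) (use that in auto)
  define G where "G = D (P (Suc n))"
  have PS: "degree (P k) \<le> k" "coeff (P k) k = 1" for k
    using monic_orthogonal_familyD(1,2)[OF P, of k] by auto
  have G: "degree G \<le> n" "coeff G n = ga (Suc n)"
    unfolding G_def using degree_D_le[OF PS(1)] coeff_D_top[OF PS(1)] PS(2) by simp_all
  have TGdeg: "degree (raise_op \<phi> \<psi> G) \<le> n"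
    using degree_diff_cancel_less[of "raise_op \<phi> \<psi> G" n 0] degree_raise_op[OF deg G(1)] dn by simp
  \<comment> \<open>Three ranges of k: the equation itself settles k = 0, the degree drop caused by
    d_n = 0 settles k > n, and for the others symmetry of the form f, g \<mapsto> u'(f g) exchanges
    the roles of \<open>P k\<close> and \<open>P (Suc n)\<close>.\<close>
  have "u (P k * raise_op \<phi> \<psi> G) = 0" for k
  proof (cases "k = 0 \<or> k > n")
    case True
    have "u (P 0 * raise_op \<phi> \<psi> G) = 0"
      using monic_orthogonal_family_0[OF PN] u(2) by simp
    then show ?thesis
      using True orthogonal_lower_degree[OF u(1) PN[of k] order_refl TGdeg] by auto
  next
    case False
    then obtain m where m: "k = Suc m" "m < n" by (cases k) auto
    have "\<alpha> * u (raise_op \<phi> \<psi> G * P k) = \<alpha> * u (raise_op \<phi> \<psi> (D (P k)) * P (Suc n))"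
      unfolding derived_mult_D[OF p, symmetric] by (simp add: G_def mult.commute)
    also have "u (raise_op \<phi> \<psi> (D (P k)) * P (Suc n)) = 0"
      using orthogonal_lower_degree[OF u(1) PN order_refl degree_raise_op(1)[OF deg degree_D_le[of "P k" m]]]
        PS(1)[of k] m by (simp add: mult.commute)
    finally show ?thesis using alpha_nonzero by (simp add: mult.commute)
  qed
  then have TG: "\<phi> * D G + \<psi> * S G = 0" using regular[of "raise_op \<phi> \<psi> G"] by (simp add: raise_op_def)
  have "u (P k * companion_op \<phi> \<psi> G) = 0" for k
  proof -
    \<comment> \<open>With \<open>P k\<close> as a difference, the product rule turns
      \<open>P k * companion_op \<phi> \<psi> G\<close> into a value of \<open>raise_op\<close>,
      since the term with \<open>TG\<close> vanishes.\<close>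
    obtain g where g: "D g = P k" using D_surj by blast
    have "raise_op \<phi> \<psi> (G * g) = (\<phi> * D G + \<psi> * S G) * S g + companion_op \<phi> \<psi> G * D g"
      unfolding raise_op_def companion_op_def D_mult S_mult by algebra
    then have "raise_op \<phi> \<psi> (G * g) = P k * companion_op \<phi> \<psi> G" unfolding TG g by (simp add: mult.commute)
    then show ?thesis using u(2) by metis
  qed
  then have NG: "\<phi> * S G + \<psi> * V * D G = 0" using regular[of "companion_op \<phi> \<psi> G"] by (simp add: companion_op_def)
  \<comment> \<open>The determinant of the system for \<phi> and \<psi>; eliminating each unknown as
    in Cramer's rule shows that it annihilates both.\<close>
  define K where "K = S G * S G - V * (D G * D G)"
  have "\<phi> * K = S G * (\<phi> * S G + \<psi> * V * D G) - V * D G * (\<phi> * D G + \<psi> * S G)"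
    "\<psi> * K = S G * (\<phi> * D G + \<psi> * S G) - D G * (\<phi> * S G + \<psi> * V * D G)"
    unfolding K_def by algebra+
  then have "\<phi> * K = 0" "\<psi> * K = 0" unfolding TG NG by simp_all
  then have K0: "K = 0" using nz by auto
  have SS: "coeff (S G * S G) (n + n) = (al n)\<^sup>2 * (coeff G n)\<^sup>2"
    using coeff_mult_degree_bounds[of "S G" n "S G" n] degree_S_le[OF G(1)] coeff_S_top[OF G(1)]
    by (simp add: power2_eq_square)
  have "coeff (V * (D G * D G)) (n + n) = (\<alpha>\<^sup>2 - 1) * (ga n)\<^sup>2 * (coeff G n)\<^sup>2"
  proof (cases n)
    case 0
    then obtain l where "G = [:l:]" using G by (auto elim: degree_eq_zeroE)
    then show ?thesis by (simp add: D_const 0)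
  next
    case (Suc m)
    have D: "degree (D G) \<le> m" "coeff (D G) m = ga n * coeff G n"
      using G(1) degree_D_le[of G m] coeff_D_top[of G m] Suc by auto
    have cfV: "centred_coeff V i = (if i = 2 then \<alpha>\<^sup>2 - 1 else if i = 0 then - 4 * (\<alpha>\<^sup>2 - 1) * \<omega> else 0)" for i
    proof -
      have one: "centred_coeff 1 i = (if i = 0 then 1 else 0)" for i using centred_coeff_const[of 1 i] by (simp add: one_pCons)
      consider "i = 0" | "i = Suc 0" | j where "i = Suc (Suc j)" by (metis not0_implies_Suc)
      then show ?thesis by cases (use centred_coeff_V_mult[of 1] one in \<open>simp_all\<close>)
    qed
    have V: "degree V \<le> 2" by (rule centred_coeff_degree_le) (simp add: cfV)
    then have "coeff V 2 = \<alpha>\<^sup>2 - 1" using centred_coeff_top[of V 2] cfV by simp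
    moreover have "degree (D G * D G) \<le> m + m" using D by (intro order_trans[OF degree_mult_le]) simp
    ultimately have "coeff (V * (D G * D G)) (2 + (m + m)) = (\<alpha>\<^sup>2 - 1) * (ga n * coeff G n * (ga n * coeff G n))"
      using coeff_mult_degree_bounds[OF V] coeff_mult_degree_bounds[OF D(1) D(1)] D(2) by simp
    then show ?thesis using Suc by (simp add: power2_eq_square algebra_simps)
  qed
  \<comment> \<open>By \<open>al_ga_pythagoras\<close> the bracket is 1, so this coefficient is the
    square of \<gamma>_(n+1).\<close>
  then have "coeff K (n + n) = ((al n)\<^sup>2 - (\<alpha>\<^sup>2 - 1) * (ga n)\<^sup>2) * (coeff G n)\<^sup>2"
    unfolding K_def coeff_diff SS by (simp add: algebra_simps)
  then show False using K0 G(2) ga_nonzero[of "Suc n"] al_ga_pythagoras by simp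
qed

section \<open>The recurrence and the two cases of the theorem\<close>

lemma recurrence:
  assumes p: "pearson u \<phi> \<psi>" and P: "monic_orthogonal_family u {0..L + 1} P"
    and d: "\<And>j. j \<le> 2 * L + 1 \<Longrightarrow> dcoeff \<phi> \<psi> j \<noteq> 0"
    and B0: "B 0 = c + node \<phi> \<psi> 0"
    and B: "\<And>n. n < L \<Longrightarrow> B (n + 1) = c - ga (n + 1) * node \<phi> \<psi> n + ga (n + 2) * node \<phi> \<psi> (n + 1)"
    and C: "\<And>n. n < L \<Longrightarrow> C (n + 1) = norm_quotient \<phi> \<psi> n"
  shows "three_term_recurrence {0..L} B C P"
proof -
  have u: "u \<in> poly_dual" using p unfolding pearson_def by auto
  have P0: "P 0 = 1" by (rule monic_orthogonal_family_0[OF P])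
  have PN: "monic_orthogonal_family u {0..Suc n} P" if "n \<le> L" for n
    by (rule monic_orthogonal_family_subset[OF P]) (use that in auto)
  have second: "centred_coeff (P (Suc n)) n = - ga (Suc n) * node \<phi> \<psi> n" if "n \<le> L" for n
    by (rule second_coefficient[OF p PN]) (use that d in auto)
  have Pn: "degree (P n) = n" "centred_coeff (P n) n = 1" if "n \<le> L + 1" for n
    using monic_orthogonal_familyD(1,2)[OF P, of n] centred_coeff_top[of "P n" n] that by auto
  have x: "[:- b, 1:] * p = \<xi> * p - smult (b - c) p" for b p
    by (simp add: \<xi>_def algebra_simps smult_diff_left)
  have "P (n + 1) = [:- B n, 1:] * P n - (if n = 0 then 0 else smult (C n) (P (n - 1)))" if n: "n \<le> L" for n
  proof (cases n)
    case 0
    have "P 1 = [:centred_coeff (P 1) 0:] + [:centred_coeff (P 1) 1:] * \<xi>" using degree_1_expand Pn(1)[of 1] by simp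
    then have "P 1 = [:- node \<phi> \<psi> 0:] + \<xi>" using Pn(2)[of 1] second[of 0] by simp
    then show ?thesis using 0 P0 B0 by (simp add: \<xi>_def)
  next
    case (Suc m)
    let ?R = "P (m + 2) - [:- B (m + 1), 1:] * P (m + 1)"
    \<comment> \<open>The coefficient at m + 2 cancels by monicity; the one at m + 1 cancels because
      B is the difference of two second coefficients.\<close>
    have "centred_coeff ?R i = 0" if i: "i > m" for i
    proof -
      have R: "centred_coeff ?R (Suc j) = centred_coeff (P (m + 2)) (Suc j) - centred_coeff (P (m + 1)) j + (B (m + 1) - c) * centred_coeff (P (m + 1)) (Suc j)" for j
        unfolding x centred_coeff_diff centred_coeff_smult by simp
      consider "i = Suc m" | "i = Suc (Suc m)" | j where "i = Suc j" "j > Suc m"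
        using i by (metis Suc_lessE not_less_eq nat_neq_iff)
      then show ?thesis
      proof cases
        case 1
        then show ?thesis
          unfolding 1 R using second[of m] second[of "Suc m"] Pn(2)[of "Suc m"] B[of m] n Suc by simp
      next
        case 2
        then show ?thesis
          unfolding 2 R using Pn(2)[of "Suc (Suc m)"] Pn(2)[of "Suc m"] Pn(1)[of "Suc m"] n Suc
            centred_coeff_eq_0[of "P (Suc m)" "Suc (Suc m)"] by simp
      next
        case 3
        then show ?thesis
          unfolding 3 R using Pn(1)[of "Suc (Suc m)"] Pn(1)[of "Suc m"] n Suc
            centred_coeff_eq_0[of "P (Suc m)"] centred_coeff_eq_0[of "P (Suc (Suc m))"] by simp
      qed
    qed
    then have "degree ?R \<le> m" by (rule centred_coeff_degree_le)
    moreover have "u (P (m + 1) * P (m + 1)) = C (m + 1) * u (P m * P m)"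
      using norm_ratio[OF p PN[of m]] d C[of m] n Suc by simp
    ultimately have "P (m + 2) = [:- B (m + 1), 1:] * P (m + 1) - smult (C (m + 1)) (P m)"
      using orthogonal_three_term[OF u P] n Suc by simp
    then show ?thesis using Suc by simp
  qed
  then show ?thesis using P0 unfolding three_term_recurrence_def by simp
qed

lemma finite_case:
  assumes p: "pearson u \<phi> \<psi>" and u1: "u 1 \<noteq> 0" and d: "\<forall>j\<le>2 * L + 1. dcoeff \<phi> \<psi> j \<noteq> 0"
    and B0: "B 0 = c + node \<phi> \<psi> 0"
    and B: "\<And>n. B (n + 1) = c - ga (n + 1) * node \<phi> \<psi> n + ga (n + 2) * node \<phi> \<psi> (n + 1)"
    and C: "\<And>n. C (n + 1) = norm_quotient \<phi> \<psi> n"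
  shows "(\<exists>P. monic_orthogonal_family u {0..L + 1} P) \<longleftrightarrow> (\<forall>n\<le>L. Phi \<phi> \<psi> n (node \<phi> \<psi> n) \<noteq> 0)"
    and "\<forall>n\<le>L. Phi \<phi> \<psi> n (node \<phi> \<psi> n) \<noteq> 0 \<Longrightarrow>
      monic_orthogonal_family u {0..L + 1} P \<longleftrightarrow> three_term_recurrence {0..L} B C P"
    and "monic_orthogonal_family u {0..L + 1} P \<Longrightarrow> C (L + 1) = u ((P (L + 1))\<^sup>2) / u ((P L)\<^sup>2)"
proof -
  have ratio: "u (P (Suc n) * P (Suc n)) = norm_quotient \<phi> \<psi> n * u (P n * P n)"
    if P: "monic_orthogonal_family u {0..L + 1} P" and n: "n \<le> L" for P n
    by (rule norm_ratio[OF p monic_orthogonal_family_subset[OF P]]) (use n d in auto)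
  have rec: "three_term_recurrence {0..L} B C P" if P: "monic_orthogonal_family u {0..L + 1} P" for P
    by (rule recurrence[OF p P]) (use d B0 B C in auto)
  have ex: "\<exists>P. monic_orthogonal_family u {0..L + 1} P" if "\<forall>n\<le>L. Phi \<phi> \<psi> n (node \<phi> \<psi> n) \<noteq> 0"
    by (rule orthogonal_family_exists[OF p u1]) (use d that in auto)
  have "Phi \<phi> \<psi> n (node \<phi> \<psi> n) \<noteq> 0" if P: "monic_orthogonal_family u {0..L + 1} P" and n: "n \<le> L" for P n
    using ratio[OF P n] monic_orthogonal_familyD(3)[OF P, of "Suc n"] n by (auto simp: norm_quotient_def)
  then show "(\<exists>P. monic_orthogonal_family u {0..L + 1} P) \<longleftrightarrow> (\<forall>n\<le>L. Phi \<phi> \<psi> n (node \<phi> \<psi> n) \<noteq> 0)"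
    using ex by blast
  show "monic_orthogonal_family u {0..L + 1} P \<longleftrightarrow> three_term_recurrence {0..L} B C P"
    if nz: "\<forall>n\<le>L. Phi \<phi> \<psi> n (node \<phi> \<psi> n) \<noteq> 0"
  proof
    assume P: "three_term_recurrence {0..L} B C P"
    \<comment> \<open>Any solution of the recurrence agrees up to index \<open>L + 1\<close> with
      this family, and so inherits orthogonality.\<close>
    obtain P' where P': "monic_orthogonal_family u {0..L + 1} P'" using ex[OF nz] by blast
    show "monic_orthogonal_family u {0..L + 1} P"
      by (rule monic_orthogonal_family_cong[OF P']) (use three_term_recurrence_unique[OF P rec[OF P']] in simp)
  qed (rule rec)
  show "C (L + 1) = u ((P (L + 1))\<^sup>2) / u ((P L)\<^sup>2)" if P: "monic_orthogonal_family u {0..L + 1} P"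
    using ratio[OF P order_refl] C[of L] monic_orthogonal_familyD(3)[OF P, of L]
    by (simp add: power2_eq_square)
qed

text \<open>Both notions on all of the naturals reduce to their truncations, where
  \<open>finite_case\<close> applies. Existence follows without gluing: one sequence defined by the
  recurrence is orthogonal on every initial segment.\<close>

lemma infinite_case:
  assumes p: "pearson u \<phi> \<psi>" and u1: "u 1 \<noteq> 0" and nz: "\<not> (\<phi> = 0 \<and> \<psi> = 0)"
    and B0: "B 0 = c + node \<phi> \<psi> 0"
    and B: "\<And>n. B (n + 1) = c - ga (n + 1) * node \<phi> \<psi> n + ga (n + 2) * node \<phi> \<psi> (n + 1)"
    and C: "\<And>n. C (n + 1) = norm_quotient \<phi> \<psi> n"
  shows "(\<exists>P. monic_orthogonal_family u UNIV P)
      \<longleftrightarrow> (\<forall>j. dcoeff \<phi> \<psi> j \<noteq> 0) \<and> (\<forall>n. Phi \<phi> \<psi> n (node \<phi> \<psi> n) \<noteq> 0)"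
    and "(\<forall>j. dcoeff \<phi> \<psi> j \<noteq> 0) \<and> (\<forall>n. Phi \<phi> \<psi> n (node \<phi> \<psi> n) \<noteq> 0) \<Longrightarrow>
      monic_orthogonal_family u UNIV P \<longleftrightarrow> three_term_recurrence UNIV B C P"
proof -
  have iff: "monic_orthogonal_family u UNIV P \<longleftrightarrow> three_term_recurrence UNIV B C P"
    if "(\<forall>j. dcoeff \<phi> \<psi> j \<noteq> 0) \<and> (\<forall>n. Phi \<phi> \<psi> n (node \<phi> \<psi> n) \<noteq> 0)" for P
    unfolding monic_orthogonal_family_UNIV three_term_recurrence_UNIV
    using finite_case(2)[OF p u1 _ B0 B C] that by simp
  show "(\<exists>P. monic_orthogonal_family u UNIV P)
      \<longleftrightarrow> (\<forall>j. dcoeff \<phi> \<psi> j \<noteq> 0) \<and> (\<forall>n. Phi \<phi> \<psi> n (node \<phi> \<psi> n) \<noteq> 0)"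
  proof
    assume "\<exists>P. monic_orthogonal_family u UNIV P"
    then obtain P where P: "monic_orthogonal_family u UNIV P" ..
    have d: "dcoeff \<phi> \<psi> j \<noteq> 0" for j by (rule regular_imp_dcoeff_nonzero[OF p P nz])
    moreover have "Phi \<phi> \<psi> n (node \<phi> \<psi> n) \<noteq> 0" for n
      using finite_case(1)[OF p u1 _ B0 B C, of n] d P monic_orthogonal_family_UNIV[of u P] by blast
    ultimately show "(\<forall>j. dcoeff \<phi> \<psi> j \<noteq> 0) \<and> (\<forall>n. Phi \<phi> \<psi> n (node \<phi> \<psi> n) \<noteq> 0)" by blast
  next
    assume "(\<forall>j. dcoeff \<phi> \<psi> j \<noteq> 0) \<and> (\<forall>n. Phi \<phi> \<psi> n (node \<phi> \<psi> n) \<noteq> 0)"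
    from iff[OF this] show "\<exists>P. monic_orthogonal_family u UNIV P" using three_term_recurrence_exists by blast
  qed
  show "monic_orthogonal_family u UNIV P \<longleftrightarrow> three_term_recurrence UNIV B C P"
    if "(\<forall>j. dcoeff \<phi> \<psi> j \<noteq> 0) \<and> (\<forall>n. Phi \<phi> \<psi> n (node \<phi> \<psi> n) \<noteq> 0)"
    by (rule iff[OF that])
qed

end

section \<open>Lattices of the q-exponential branch\<close>

locale q_exponential_lattice =
  fixes h :: complex and U :: "complex set" and X :: "complex \<Rightarrow> complex" and q r c :: complex
  assumes inv: "half_step_invariant h U" and adm: "admissible h U X"
    and branch: "q_exponential_branch h U X"
    and q_nonzero: "q \<noteq> 0" and q_generic: "n > 0 \<Longrightarrow> q ^ n \<noteq> 1"
    and r_square: "r\<^sup>2 = q" and r_eta: "r + inverse r = lattice_eta h U X"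
    and c_eq: "c = (lattice_eta h U X + 2) * lattice_beta h U X / (2 - ((lattice_eta h U X)\<^sup>2 - 2))"
begin

definition progression :: "complex \<Rightarrow> complex \<Rightarrow> complex \<Rightarrow> bool" where
  "progression s a b \<longleftrightarrow> (\<forall>k::int. X (s + of_int k * h) = a * q powi k + b * q powi (- k) + c)"

lemma r_nonzero: "r \<noteq> 0"
  using q_nonzero r_square by auto

lemma q_root: "q + inverse q = (lattice_eta h U X)\<^sup>2 - 2"
  unfolding r_eta[symmetric] r_square[symmetric] using r_nonzero
  by (simp add: power2_sum power_inverse)

lemma r_diff_nonzero: "r - inverse r \<noteq> 0"
proof
  assume "r - inverse r = 0"
  then have "r * r = 1" using r_nonzero by (metis eq_iff_diff_eq_0 right_inverse)
  then show False using q_generic[of 1] r_square by (simp add: power2_eq_square)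
qed

text \<open>Since 2 - A = (2 + \<eta>) (2 - \<eta>), the centre c is \<beta> / (2 - \<eta>), the
  fixed point of the half-step rule.\<close>

lemma beta: "lattice_beta h U X = (2 - (r + inverse r)) * c"
proof -
  define w where "w = lattice_eta h U X"
  have w: "w + 2 \<noteq> 0" "2 - w \<noteq> 0"
    using branch unfolding q_exponential_branch_def w_def by (auto simp: eq_neg_iff_add_eq_0)
  have "2 - (w\<^sup>2 - 2) = (w + 2) * (2 - w)" by (simp add: power2_eq_square algebra_simps)
  then have "c = lattice_beta h U X / (2 - w)" using c_eq w unfolding w_def[symmetric] by simp
  then show ?thesis unfolding r_eta w_def[symmetric] using w by simp
qed

lemma progression_exists:
  assumes "s \<in> U"
  shows "\<exists>a b. progression s a b"
  using progression_coeffs_ex1[OF adm inv branch refl refl refl refl q_nonzero q_root c_eq assms]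
  unfolding progression_def by blast

lemma sum_half_steps:
  assumes "s \<in> U"
  shows "X (s + h / 2) + X (s - h / 2) = (r + inverse r) * X s + (2 - (r + inverse r)) * c"
  using lattice_consts_eq[OF adm assms] unfolding beta r_eta .

text \<open>Adding X at s and at s + h gives \<eta> X (s + h / 2) + \<beta>. As \<eta> is not 0, the
  half-step values follow, with the compatible root \<open>r\<close> as multiplier.\<close>

lemma progression_half_steps:
  assumes s: "s \<in> U" and ab: "progression s a b"
  shows "X s = c + a + b" "X (s + h / 2) = c + r * a + inverse r * b"
    "X (s - h / 2) = c + inverse r * a + r * b"
proof -
  define t where "t = inverse r"
  have rt: "r * t = 1" using r_nonzero by (simp add: t_def)
  have \<eta>: "r + t \<noteq> 0" using branch unfolding q_exponential_branch_def r_eta[symmetric] t_def by auto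
  have u: "s + h / 2 \<in> U" "s - h / 2 \<in> U" using inv s unfolding half_step_invariant_def by auto
  have arith: "s + h / 2 + h / 2 = s + h" "s + h / 2 - h / 2 = s"
    "s - h / 2 + h / 2 = s" "s - h / 2 - h / 2 = s - h" by (simp_all add: algebra_simps)
  have q: "q = r * r" "inverse q = t * t" using r_square by (auto simp: power2_eq_square t_def)
  show X0: "X s = c + a + b"
    using ab[unfolded progression_def, rule_format, of 0] by simp
  have X1: "X (s + h) = c + a * (r * r) + b * (t * t)"
    using ab[unfolded progression_def, rule_format, of 1] by (simp add: power_int_minus q t_def)
  have X2: "X (s - h) = c + a * (t * t) + b * (r * r)"
    using ab[unfolded progression_def, rule_format, of "- 1"] by (simp add: power_int_minus q t_def)
  have "(r + t) * X (s + h / 2) = (r + t) * (c + r * a + t * b)"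
    using sum_half_steps[OF u(1)] rt unfolding arith X0 X1 t_def[symmetric] by algebra
  then show "X (s + h / 2) = c + r * a + inverse r * b" using \<eta> unfolding t_def by simp
  have "(r + t) * X (s - h / 2) = (r + t) * (c + t * a + r * b)"
    using sum_half_steps[OF u(2)] rt unfolding arith X0 X2 t_def[symmetric] by algebra
  then show "X (s - h / 2) = c + inverse r * a + r * b" using \<eta> unfolding t_def by simp
qed

lemma half_step_diff:
  assumes s: "s \<in> U" and ab: "progression s a b"
  shows "X (s + h / 2) - X (s - h / 2) = (r - inverse r) * (a - b)" "a \<noteq> b"
proof -
  show *: "X (s + h / 2) - X (s - h / 2) = (r - inverse r) * (a - b)"
    unfolding progression_half_steps(2,3)[OF assms] by algebra
  have "X (s + h / 2) - X (s - h / 2) \<noteq> 0" using adm s unfolding admissible_def parametrising_def by blast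
  then show "a \<noteq> b" unfolding * by auto
qed

lemma progression_shift:
  assumes "progression s a b"
  shows "progression (s + of_int j * h) (a * q powi j) (b * q powi (- j))"
  unfolding progression_def
proof
  fix k :: int
  have eq: "s + of_int j * h + of_int k * h = s + of_int (j + k) * h" by (simp add: algebra_simps)
  have "q powi (j + k) = q powi j * q powi k" "q powi (- (j + k)) = q powi (- j) * q powi (- k)"
    using q_nonzero power_int_add[of q j k] power_int_add[of q "- j" "- k"] by simp_all
  then show "X (s + of_int j * h + of_int k * h)
      = a * q powi j * q powi k + b * q powi (- j) * q powi (- k) + c"
    unfolding eq assms[unfolded progression_def, rule_format] by (simp only: mult.assoc)
qed

lemma progression_infinite:
  assumes s: "s \<in> U" and ab: "progression s a b"
  shows "infinite (range (\<lambda>n. X (s + of_nat n * h)))"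
proof
  let ?f = "\<lambda>n. X (s + of_nat n * h)"
  assume "finite (range ?f)"
  then obtain m where m: "infinite {n. ?f n = ?f m}" using pigeonhole_infinite[of UNIV ?f] by auto
  \<comment> \<open>If the value \<open>?f m\<close> is attained at n, then q^n is a root of this
    polynomial, which is nonzero because a and b differ. Powers of q are distinct, so each value is
    attained only finitely often.\<close>
  let ?p = "[:b, c - ?f m, a:]"
  have inj: "inj (\<lambda>n. q ^ n)"
  proof (rule linorder_injI)
    fix i j :: nat assume "i < j"
    then show "q ^ i \<noteq> q ^ j"
      using q_generic[of "j - i"] q_nonzero power_add[of q i "j - i"] by auto
  qed
  have "poly ?p (q ^ n) = 0" if n: "?f n = ?f m" for n
  proof -
    have "?f n = a * q ^ n + b * inverse (q ^ n) + c"
      using ab[unfolded progression_def, rule_format, of "int n"] by (simp add: power_int_minus)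
    then have "?f m * q ^ n = (a * q ^ n + b * inverse (q ^ n) + c) * q ^ n" using n by simp
    also have "\<dots> = a * q ^ n * q ^ n + b + c * q ^ n" using q_nonzero by (simp add: algebra_simps)
    finally show ?thesis by (simp add: algebra_simps)
  qed
  then have "(\<lambda>n. q ^ n) ` {n. ?f n = ?f m} \<subseteq> {x. poly ?p x = 0}" by auto
  moreover have "?p \<noteq> 0" using half_step_diff(2)[OF assms] by auto
  then have "finite {x. poly ?p x = 0}" by (rule poly_roots_finite)
  ultimately have "finite ((\<lambda>n. q ^ n) ` {n. ?f n = ?f m})" by (rule finite_subset)
  then show False using m inj by (meson finite_imageD inj_on_subset subset_UNIV)
qed

text \<open>On a progression \<open>(Y - Z)\<^sup>2 = (r - r\<^sup>-\<^sup>1)\<^sup>2 ((X - c)\<^sup>2 - 4 a b)\<close>, and \<open>(Y - Z)\<^sup>2\<close> is a polynomial in \<open>X\<close> by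
  admissibility. So \<open>a b\<close> is a polynomial in \<open>X\<close> that is constant on one infinite progression.\<close>

lemma product_independent:
  assumes s: "s \<in> U" "progression s a b" and s': "s' \<in> U" "progression s' a' b'"
  shows "a' * b' = a * b"
proof -
  define w where "w = (r - inverse r)\<^sup>2"
  have w: "w \<noteq> 0" using r_diff_nonzero by (simp add: w_def)
  \<comment> \<open>As (Y - Z)^2 = 2 (Y^2 + Z^2) - (Y + Z)^2, the last two terms give - (Y - Z)^2 on
    the lattice.\<close>
  define G where "G = smult w ([:- c, 1:]\<^sup>2) - smult 4 (averaging h U X [:0, 0, 1:])
      + [:(2 - (r + inverse r)) * c, r + inverse r:]\<^sup>2"
  have G: "poly G (X t) = 4 * w * (k * l)" if t: "t \<in> U" "progression t k l" for t k l
  proof -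
    define y z where "y = X (t + h / 2)" and "z = X (t - h / 2)"
    define v where "v = poly (averaging h U X [:0, 0, 1:]) (X t)"
    have "2 * v = y * y + z * z"
      using averaging_eq[OF adm t(1), of "[:0, 0, 1:]"] unfolding v_def y_def z_def by (simp add: mult.commute)
    moreover have "(y - z)\<^sup>2 = w * (k - l)\<^sup>2"
      unfolding y_def z_def half_step_diff(1)[OF t] w_def by (simp add: power_mult_distrib)
    moreover have "X t - c = k + l" using progression_half_steps(1)[OF t] by simp
    moreover have "(2 - (r + inverse r)) * c + X t * (r + inverse r) = y + z"
      using sum_half_steps[OF t(1)] unfolding y_def z_def by (simp add: algebra_simps)
    moreover have "poly G (X t) = w * (X t - c)\<^sup>2 - 4 * v
        + ((2 - (r + inverse r)) * c + X t * (r + inverse r))\<^sup>2"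
      unfolding G_def by (simp add: v_def)
    ultimately show ?thesis by algebra
  qed
  have "poly G (X (s + of_nat n * h)) = 4 * w * (a * b)" for n
  proof -
    have "progression (s + of_nat n * h) (a * q powi int n) (b * q powi (- int n))"
      using progression_shift[OF s(2), of "int n"] by simp
    moreover have "s + of_nat n * h \<in> U" using half_step_invariant_int[OF inv s(1), of "int n"] by simp
    ultimately show ?thesis using G q_nonzero by (simp add: power_int_minus)
  qed
  then have "range (\<lambda>n. X (s + of_nat n * h)) \<subseteq> {x. poly (G - [:4 * w * (a * b):]) x = 0}" by auto
  then have "infinite {x. poly (G - [:4 * w * (a * b):]) x = 0}"
    using progression_infinite[OF s] finite_subset by blast
  then have "G = [:4 * w * (a * b):]" using poly_roots_finite[of "G - [:4 * w * (a * b):]"] by auto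
  then show ?thesis using G[OF s'] w by simp
qed

text \<open>Polynomials are determined by their values on the infinite image of the lattice, so
  operator laws can be checked pointwise.\<close>

lemma div_diff_eqI:
  assumes "\<And>s. s \<in> U \<Longrightarrow> poly p (X s) =
    (poly f (X (s + h / 2)) - poly f (X (s - h / 2))) / (X (s + h / 2) - X (s - h / 2))"
  shows "div_diff h U X f = p"
proof (rule poly_eq_on_image)
  show "infinite (X ` U)" using adm unfolding admissible_def by blast
qed (simp only: assms div_diff_eq[OF adm])

lemma averaging_eqI:
  assumes "\<And>s. s \<in> U \<Longrightarrow> poly p (X s) = (poly f (X (s + h / 2)) + poly f (X (s - h / 2))) / 2"
  shows "averaging h U X f = p"
proof (rule poly_eq_on_image)
  show "infinite (X ` U)" using adm unfolding admissible_def by blast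
qed (simp only: assms averaging_eq[OF adm])

lemma lattice_calculus:
  assumes s0: "s\<^sub>0 \<in> U" and ab0: "progression s\<^sub>0 a b"
  shows "lattice_calculus (div_diff h U X) (averaging h U X) r c (a * b)"
proof
  let ?D = "div_diff h U X" and ?S = "averaging h U X"
  have nz: "X (s + h / 2) - X (s - h / 2) \<noteq> 0" if "s \<in> U" for s
    using adm that unfolding admissible_def parametrising_def by blast
  show "?D (f + g) = ?D f + ?D g" for f g
    by (rule div_diff_eqI) (simp add: div_diff_eq[OF adm] add_divide_distrib[symmetric])
  show "?S (f + g) = ?S f + ?S g" for f g
    by (rule averaging_eqI) (simp add: averaging_eq[OF adm] add_divide_distrib[symmetric])
  show "?D [:k:] = 0" for k by (rule div_diff_eqI) simp
  show "?S [:k:] = [:k:]" for k by (rule averaging_eqI) simp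
  show "?D [:- c, 1:] = 1" by (rule div_diff_eqI) (use nz in simp)
  show "?S [:- c, 1:] = [:(r + inverse r) / 2:] * [:- c, 1:]"
  proof (rule averaging_eqI)
    fix s assume "s \<in> U"
    from sum_half_steps[OF this]
    show "poly ([:(r + inverse r) / 2:] * [:- c, 1:]) (X s)
        = (poly [:- c, 1:] (X (s + h / 2)) + poly [:- c, 1:] (X (s - h / 2))) / 2"
      by (simp add: algebra_simps add_divide_distrib)
  qed
  show "?D (f * g) = ?D f * ?S g + ?S f * ?D g" for f g
  proof (rule div_diff_eqI)
    fix s assume s: "s \<in> U"
    define t where "t = X (s + h / 2) - X (s - h / 2)"
    have "t \<noteq> 0" using nz[OF s] by (simp add: t_def)
    then show "poly (?D f * ?S g + ?S f * ?D g) (X s)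
      = (poly (f * g) (X (s + h / 2)) - poly (f * g) (X (s - h / 2))) / (X (s + h / 2) - X (s - h / 2))"
      unfolding poly_add poly_mult div_diff_eq[OF adm s] averaging_eq[OF adm s] t_def[symmetric]
      by (simp add: field_simps)
  qed
  show "?S (f * g) = [:((r + inverse r) / 2)\<^sup>2 - 1:] * ([:- c, 1:]\<^sup>2 - [:4 * (a * b):]) * ?D f * ?D g
      + ?S f * ?S g" for f g
  proof (rule averaging_eqI)
    fix s assume s: "s \<in> U"
    \<comment> \<open>Each s has its own progression coefficients; that their product equals
      \<open>a * b\<close> is what allows one polynomial to represent ((Y - Z) / 2)^2 throughout
      \<open>U\<close>.\<close>
    obtain k l where kl: "progression s k l" using progression_exists[OF s] by blast
    define t v where "t = X (s + h / 2) - X (s - h / 2)"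
      and "v = (((r + inverse r) / 2)\<^sup>2 - 1) * ((X s - c)\<^sup>2 - 4 * (a * b))"
    have t: "t \<noteq> 0" using nz[OF s] by (simp add: t_def)
    have 1: "((r + inverse r) / 2)\<^sup>2 - 1 = ((r - inverse r) / 2)\<^sup>2"
      using r_nonzero by (simp add: field_simps power2_eq_square)
    have 2: "(X s - c)\<^sup>2 - 4 * (a * b) = (k - l)\<^sup>2"
      unfolding progression_half_steps(1)[OF s kl] product_independent[OF s0 ab0 s kl, symmetric]
      by (simp add: power2_eq_square algebra_simps)
    have v: "v = (t / 2)\<^sup>2"
      unfolding v_def 1 2 t_def half_step_diff(1)[OF s kl] by (simp add: power_mult_distrib power_divide)
    have "poly ([:((r + inverse r) / 2)\<^sup>2 - 1:] * ([:- c, 1:]\<^sup>2 - [:4 * (a * b):]) * ?D f * ?D g + ?S f * ?S g) (X s)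
      = v * poly (?D f) (X s) * poly (?D g) (X s) + poly (?S f) (X s) * poly (?S g) (X s)"
    proof -
      have *: "poly [:- c, 1:] (X s) = X s - c" by simp
      show ?thesis unfolding v_def poly_add poly_mult poly_diff poly_power * by simp
    qed
    also have "\<dots> = (poly (f * g) (X (s + h / 2)) + poly (f * g) (X (s - h / 2))) / 2"
      unfolding div_diff_eq[OF adm s] averaging_eq[OF adm s] t_def[symmetric] poly_mult v using t
      by (simp add: field_simps power2_eq_square)
    finally show "poly ([:((r + inverse r) / 2)\<^sup>2 - 1:] * ([:- c, 1:]\<^sup>2 - [:4 * (a * b):]) * ?D f * ?D g + ?S f * ?S g) (X s)
      = (poly (f * g) (X (s + h / 2)) + poly (f * g) (X (s - h / 2))) / 2" .
  qed
  show "r \<noteq> 0" by (rule r_nonzero)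
  show "r ^ (2 * n) \<noteq> 1" if "n > 0" for n using q_generic[OF that] by (simp add: power_mult r_square)
  show "r + inverse r \<noteq> 0" using branch unfolding r_eta q_exponential_branch_def by simp
qed

end


section \<open>Translation into the notation of the theorem\<close>

theorem theorem7p5:
  fixes h :: complex and U :: "complex set" and X :: "complex \<Rightarrow> complex"
    and u :: "complex poly \<Rightarrow> complex"
    and \<phi> \<psi> :: "complex poly" and \<phi>\<^sub>0 \<phi>\<^sub>1 \<phi>\<^sub>2 \<psi>\<^sub>0 \<psi>\<^sub>1 :: complex
    and \<eta> \<beta> A B\<^sub>X q r s\<^sub>0 c a b \<Pi>\<^sub>X :: complex
    and \<alpha> \<gamma> d e :: "nat \<Rightarrow> complex"
    and \<Phi> :: "nat \<Rightarrow> complex \<Rightarrow> complex"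
    and B C :: "nat \<Rightarrow> complex"
  assumes "h \<noteq> 0" and "half_step_invariant h U" and "admissible h U X"
    and "u \<in> poly_dual" and "u 1 \<noteq> 0"
    and "\<phi> = [:\<phi>\<^sub>0, \<phi>\<^sub>1, \<phi>\<^sub>2:]" and "\<psi> = [:\<psi>\<^sub>0, \<psi>\<^sub>1:]" and "\<not> (\<phi> = 0 \<and> \<psi> = 0)"
    and "div_diff_dual h U X (poly_mult_dual \<phi> u) = averaging_dual h U X (poly_mult_dual \<psi> u)"
    and "q_exponential_branch h U X"
    and "\<eta> = lattice_eta h U X" and "\<beta> = lattice_beta h U X"
    and "A = \<eta>\<^sup>2 - 2" and "B\<^sub>X = (\<eta> + 2) * \<beta>"
    and "q \<noteq> 0" and "q + inverse q = A" and "\<forall>n>0. q ^ n \<noteq> 1"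
    and "r\<^sup>2 = q" and "r + inverse r = \<eta>"
    and "s\<^sub>0 \<in> U" and "c = B\<^sub>X / (2 - A)"
    and "\<forall>k::int. X (s\<^sub>0 + of_int k * h) = a * q powi k + b * q powi (- k) + c"
    and "\<Pi>\<^sub>X = a * b"
    and "\<And>n. \<alpha> n = (r powi int n + r powi (- int n)) / 2"
    and "\<And>n. \<gamma> n = (r powi int n - r powi (- int n)) / (r - inverse r)"
    and "\<And>n. d n = \<phi>\<^sub>2 * \<gamma> n + \<psi>\<^sub>1 * \<alpha> n"
    and "\<And>n. e n = (2 * \<phi>\<^sub>2 * c + \<phi>\<^sub>1) * \<gamma> n + (\<psi>\<^sub>1 * c + \<psi>\<^sub>0) * \<alpha> n"
    and "\<And>n x. \<Phi> n x =
          (\<psi>\<^sub>1 * ((\<alpha> 1)\<^sup>2 - 1) * \<gamma> (2 * n) + \<phi>\<^sub>2 * \<alpha> (2 * n)) * ((x - c)\<^sup>2 - 2 * \<Pi>\<^sub>X)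
          + (poly (pderiv \<phi>) c * \<alpha> n + poly \<psi> c * ((\<alpha> 1)\<^sup>2 - 1) * \<gamma> n) * (x - c)
          + poly \<phi> c + 2 * \<phi>\<^sub>2 * \<Pi>\<^sub>X"
    and "B 0 = c - \<gamma> 1 * e 0 / d 0"
    and "C 1 = - (\<gamma> 1 / d 1) * \<Phi> 0 (c - e 0 / d 0)"
    and "\<And>n. n \<ge> 1 \<Longrightarrow>
          B n = c + \<gamma> n * e (n - 1) / d (2 * n - 2) - \<gamma> (n + 1) * e n / d (2 * n)"
    and "\<And>n. n \<ge> 1 \<Longrightarrow>
          C (n + 1) = - (\<gamma> (n + 1) * d (n - 1) / (d (2 * n - 1) * d (2 * n + 1)))
                      * \<Phi> n (c - e n / d (2 * n))"
  shows
    "(\<forall>s\<in>U. \<forall>a' b'. (\<forall>k::int. X (s + of_int k * h) = a' * q powi k + b' * q powi (- k) + c)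
        \<longrightarrow> a' * b' = \<Pi>\<^sub>X)
     \<and>
     ((\<exists>P. monic_orthogonal_family u UNIV P)
        \<longleftrightarrow> (\<forall>j. d j \<noteq> 0) \<and> (\<forall>n. \<Phi> n (c - e n / d (2 * n)) \<noteq> 0))
     \<and>
     ((\<forall>j. d j \<noteq> 0) \<and> (\<forall>n. \<Phi> n (c - e n / d (2 * n)) \<noteq> 0)
        \<longrightarrow> (\<forall>P. monic_orthogonal_family u UNIV P \<longleftrightarrow> three_term_recurrence UNIV B C P))
     \<and>
     (\<forall>N::nat. (\<forall>j \<le> 2 * N + 1. d j \<noteq> 0) \<longrightarrow>
        ((\<exists>P. monic_orthogonal_family u {0..N + 1} P)
           \<longleftrightarrow> (\<forall>n \<le> N. \<Phi> n (c - e n / d (2 * n)) \<noteq> 0))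
        \<and>
        ((\<forall>n \<le> N. \<Phi> n (c - e n / d (2 * n)) \<noteq> 0)
           \<longrightarrow> (\<forall>P. (monic_orthogonal_family u {0..N + 1} P \<longleftrightarrow> three_term_recurrence {0..N} B C P)
                  \<and> (monic_orthogonal_family u {0..N + 1} P
                       \<longrightarrow> C (N + 1) = u ((P (N + 1))\<^sup>2) / u ((P N)\<^sup>2)))))"
proof -
  note hyps = assms
  interpret Q: q_exponential_lattice h U X q r c
    using hyps(2,3,10,15,17-19,21) unfolding hyps(11-14) by unfold_locales auto
  have prog: "Q.progression s\<^sub>0 a b" unfolding Q.progression_def by (fact hyps(22))
  interpret L: lattice_calculus "div_diff h U X" "averaging h U X" r c "\<Pi>\<^sub>X"
    unfolding \<open>\<Pi>\<^sub>X = a * b\<close> by (rule Q.lattice_calculus[OF \<open>s\<^sub>0 \<in> U\<close> prog])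
  have deg: "degree \<phi> \<le> 2" "degree \<psi> \<le> 1" using hyps(6,7) by simp_all
  have cf: "L.centred_coeff \<phi> 0 = poly \<phi> c" "L.centred_coeff \<phi> 1 = 2 * \<phi>\<^sub>2 * c + \<phi>\<^sub>1" "L.centred_coeff \<phi> 2 = \<phi>\<^sub>2"
    "L.centred_coeff \<psi> 0 = \<psi>\<^sub>1 * c + \<psi>\<^sub>0" "L.centred_coeff \<psi> 1 = \<psi>\<^sub>1"
    unfolding hyps(6,7) by (simp_all add: L.centred_coeff_def pcompose_pCons numeral_2_eq_2 algebra_simps)
  have pd: "poly (pderiv \<phi>) c = 2 * \<phi>\<^sub>2 * c + \<phi>\<^sub>1" "poly \<psi> c = \<psi>\<^sub>1 * c + \<psi>\<^sub>0"
    unfolding hyps(6,7) by (simp_all add: pderiv_pCons algebra_simps)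
  have \<alpha>: "\<alpha> n = L.al n" and \<gamma>: "\<gamma> n = L.ga n" for n
    unfolding hyps(24,25) by (simp_all add: L.al_def L.ga_def power_int_minus power_inverse)
  have \<alpha>1: "\<alpha> 1 = L.\<alpha>" by (simp add: \<alpha>)
  have d: "d n = L.dcoeff \<phi> \<psi> n" and e: "e n = L.ecoeff \<phi> \<psi> n" for n
    unfolding L.dcoeff_def L.ecoeff_def cf hyps(26,27) \<alpha> \<gamma> by simp_all
  have \<Phi>: "\<Phi> n x = L.Phi \<phi> \<psi> n (x - c)" for n x
    unfolding L.Phi_def cf hyps(28) \<alpha>1 \<alpha> \<gamma> pd by simp
  \<comment> \<open>Recentring at c turns the evaluation point c - e_n / d_(2n) into
    \<open>L.node \<phi> \<psi> n\<close>.\<close>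
  have \<Phi>y: "\<Phi> n (c - e n / d (2 * n)) = L.Phi \<phi> \<psi> n (L.node \<phi> \<psi> n)" for n
    unfolding \<Phi> by (simp add: L.node_def d e)
  have "u (L.raise_op \<phi> \<psi> p) = 0" for p
    using fun_cong[OF \<open>div_diff_dual h U X (poly_mult_dual \<phi> u) = averaging_dual h U X (poly_mult_dual \<psi> u)\<close>, of p]
      poly_dual_add[OF \<open>u \<in> poly_dual\<close>]
    by (simp add: div_diff_dual_def averaging_dual_def poly_mult_dual_def L.raise_op_def add_eq_0_iff)
  then have p: "L.pearson u \<phi> \<psi>" using deg \<open>u \<in> poly_dual\<close> unfolding L.pearson_def by blast
  have B0: "B 0 = c + L.node \<phi> \<psi> 0"
    unfolding hyps(29) by (simp add: \<gamma> L.node_def d e)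
  have B: "B (n + 1) = c - L.ga (n + 1) * L.node \<phi> \<psi> n + L.ga (n + 2) * L.node \<phi> \<psi> (n + 1)" for n
    using hyps(31)[of "n + 1"] by (simp add: \<gamma> L.node_def d e)
  \<comment> \<open>The coefficient C_1 is given by its own formula, matching the separate branch of
    \<open>L.norm_quotient\<close>.\<close>
  have C: "C (n + 1) = L.norm_quotient \<phi> \<psi> n" for n
  proof (cases n)
    case 0
    then show ?thesis using hyps(30) \<Phi>y[of 0] by (simp add: L.norm_quotient_def \<gamma> d)
  next
    case (Suc m)
    then show ?thesis using hyps(32)[of n] unfolding \<Phi>y by (simp add: L.norm_quotient_def \<gamma> d)
  qed
  have product: "\<forall>s\<in>U. \<forall>a' b'. (\<forall>k::int. X (s + of_int k * h) = a' * q powi k + b' * q powi (- k) + c)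
      \<longrightarrow> a' * b' = \<Pi>\<^sub>X"
    unfolding hyps(23) Q.progression_def[symmetric] using Q.product_independent[OF hyps(20) prog] by blast
  note infinite_case = L.infinite_case[where B = B and C = C, OF p hyps(5,8) B0 B C]
  have infinite: "(\<forall>j. L.dcoeff \<phi> \<psi> j \<noteq> 0) \<and> (\<forall>n. L.Phi \<phi> \<psi> n (L.node \<phi> \<psi> n) \<noteq> 0)
      \<longrightarrow> (\<forall>P. monic_orthogonal_family u UNIV P \<longleftrightarrow> three_term_recurrence UNIV B C P)"
    by (intro impI allI) (rule infinite_case(2))
  have finite: "\<forall>M::nat. (\<forall>j \<le> 2 * M + 1. L.dcoeff \<phi> \<psi> j \<noteq> 0) \<longrightarrow>
      ((\<exists>P. monic_orthogonal_family u {0..M + 1} P)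
         \<longleftrightarrow> (\<forall>n \<le> M. L.Phi \<phi> \<psi> n (L.node \<phi> \<psi> n) \<noteq> 0))
      \<and>
      ((\<forall>n \<le> M. L.Phi \<phi> \<psi> n (L.node \<phi> \<psi> n) \<noteq> 0)
         \<longrightarrow> (\<forall>P. (monic_orthogonal_family u {0..M + 1} P \<longleftrightarrow> three_term_recurrence {0..M} B C P)
                \<and> (monic_orthogonal_family u {0..M + 1} P
                     \<longrightarrow> C (M + 1) = u ((P (M + 1))\<^sup>2) / u ((P M)\<^sup>2))))"
  proof (intro allI impI)
    fix M :: nat
    assume dM: "\<forall>j \<le> 2 * M + 1. L.dcoeff \<phi> \<psi> j \<noteq> 0"
    note finite_case = L.finite_case[where B = B and C = C, OF p hyps(5) dM B0 B C]
    show "((\<exists>P. monic_orthogonal_family u {0..M + 1} P)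
         \<longleftrightarrow> (\<forall>n \<le> M. L.Phi \<phi> \<psi> n (L.node \<phi> \<psi> n) \<noteq> 0))
      \<and>
      ((\<forall>n \<le> M. L.Phi \<phi> \<psi> n (L.node \<phi> \<psi> n) \<noteq> 0)
         \<longrightarrow> (\<forall>P. (monic_orthogonal_family u {0..M + 1} P \<longleftrightarrow> three_term_recurrence {0..M} B C P)
                \<and> (monic_orthogonal_family u {0..M + 1} P
                     \<longrightarrow> C (M + 1) = u ((P (M + 1))\<^sup>2) / u ((P M)\<^sup>2))))"
    proof (intro conjI impI allI)
      show "(\<exists>P. monic_orthogonal_family u {0..M + 1} P)
         \<longleftrightarrow> (\<forall>n \<le> M. L.Phi \<phi> \<psi> n (L.node \<phi> \<psi> n) \<noteq> 0)"
        by (rule finite_case(1))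
    next
      fix P assume "\<forall>n \<le> M. L.Phi \<phi> \<psi> n (L.node \<phi> \<psi> n) \<noteq> 0"
      then show "monic_orthogonal_family u {0..M + 1} P \<longleftrightarrow> three_term_recurrence {0..M} B C P"
        by (rule finite_case(2))
    next
      fix P assume "monic_orthogonal_family u {0..M + 1} P"
      then show "C (M + 1) = u ((P (M + 1))\<^sup>2) / u ((P M)\<^sup>2)" by (rule finite_case(3))
    qed
  qed
  show ?thesis
    unfolding \<Phi>y unfolding d by (intro conjI product infinite_case(1) infinite finite)
qed

end
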